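(* For $g\in\mathrm{Gal}_k$ and $1\le i,j\le r$, the $(i,j)$-entry of $\mathrm{Gass}_S(g)$ is $$\mathrm{Gass}_S(g)_{ij}=\begin{cases}\displaystyle\frac{\chi_{\Lambda_r}(g)(u_i)}{u_i}\Big(1+\sum_{n\ge1}\ \sum_{\substack{1\le i_1,\dots,i_n\le r\\ i_n\ne i}}\mu(g;i_1\cdots i_n i)\,u_{i_1}\cdots u_{i_n}\Big)&(i=j),\\[3ex]\displaystyle-\chi_{\Lambda_r}(g)(u_j)\Big(\mu(g;ij)+\sum_{n\ge1}\ \sum_{1\le i_1,\dots,i_n\le r}\mu(g;i_1\cdots i_n\,i\,j)\,u_{i_1}\cdots u_{i_n}\Big)&(i\ne j).\end{cases}$$
   Context: Setup. Fix a prime $l$ and $r\ge2$. $\mathfrak F_r$ is the free pro-$l$ group on $x_1,\dots,x_r$, and $x_{r+1}:=(x_1\cdots x_r)^{-1}$. $S=(P_1,\dots,P_{r+1})$ is an ordered set of distinct $\overline{\mathbb Q}$-rational points of $\mathbb P^1$ ($\overline{\mathbb Q}\subset\mathbb C$) with $P_1=0,P_2=1,P_{r+1}=\infty$; $k=\mathbb Q(S\setminus\{\infty\})$ is the number field generated by the coordinates of $P_1,\dots,P_r$; $\mathrm{Gal}_k=\mathrm{Gal}(\overline{\mathbb Q}/k)$; $\chi_l:\mathrm{Gal}_k\to\mathbb Z_l^\times$ is the $l$-cyclotomic character. The maximal pro-$l$ quotient of the étale fundamental group of $\mathbb P^1_{\overline{\mathbb Q}}\setminus S$ is identified with $\mathfrak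 F_r$, $x_i$ being the class of a small loop around $P_i$; the monodromy action of $\mathrm{Gal}_k$ gives $\Phi_S:\mathrm{Gal}_k\to\mathrm{Out}(\mathfrak F_r)$. Let $P(\mathfrak F_r)$ be the group of $\varphi\in\mathrm{Aut}(\mathfrak F_r)$ for which there is $N(\varphi)\in\mathbb Z_l^\times$ such that $\varphi(x_i)$ is conjugate to $x_i^{N(\varphi)}$ for $1\le i\le r-1$, $\varphi(x_r)$ is conjugate to $x_r^{N(\varphi)}$ by an element of the subgroup generated by $[\mathfrak F_r,\mathfrak F_r]$ and $x_1,\dots,x_{r-2}$, and $\varphi(x_{r+1})=x_{r+1}^{N(\varphi)}$. Each $\Phi_S(g)$ has a unique representative $\mathrm{Ih}_S(g)\in P(\mathfrak F_r)$; $\mathrm{Ih}_S:\mathrm{Gal}_k\to P(\mathfrak F_r)$ is a continuous homomorphism (the Ihara representation) with $N(\mathrm{Ih}_S(g))=\chi_l(g)$. Longitudes and Milnor numbers. $H=\mathfrak F_r/[\mathfrak F_r,\mathfrak F_r]$ is the free $\mathbb Z_l$-module with basis $X_i=[x_i]$ ($1\le i\le r$). $y_i(g)\in\mathfrak F_r$ is the unique element with $\mathrm{Ih}_S(g)(x_i)=y_i(g)x_i^{\chi_l(g)}y_i(g)^{-1}$ and with the coefficient of $X_i$ in $[y_i(g)]\in H$ equal to $0$. $\Theta:\mathbb Z_l[[\mathfrak F_r]]\to\mathbb Z_l\langle\langle X_1,\dots,X_r\rangle\rangle$ is the topological algebra isomorphism $x_i\mapsto1+X_i$; $\mu(J;\alpha)$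 is the coefficient of $X_{j_1}\cdots X_{j_a}$ in $\Theta(\alpha)$, $J=(j_1\cdots j_a)$. For $I=(i_1\cdots i_n)$ with $n\ge2$, $\mu(g;I):=\mu((i_1\cdots i_{n-1});y_{i_n}(g))$; $\mu(g;I):=0$ if $n=1$. Gassner cocycle. $\Lambda_r=\mathbb Z_l[[u_1,\dots,u_r]]$ (commutative). $\pi:\mathfrak F_r\to\mathfrak F_r/[\mathfrak F_r,\mathfrak F_r]$ is the abelianization (also the induced map on complete group algebras), and $\theta:\mathbb Z_l[[\mathfrak F_r/[\mathfrak F_r,\mathfrak F_r]]]\simeq\Lambda_r$ is the isomorphism $x_i\mapsto1+u_i$. $\chi_{\Lambda_r}(g)$ is the automorphism of $\Lambda_r$ with $\chi_{\Lambda_r}(g)(u_i)=(1+u_i)^{\chi_l(g)}-1$. The pro-$l$ Fox derivatives $\partial/\partial x_j$ on $\mathbb Z_l[[\mathfrak F_r]]$ are the continuous $\mathbb Z_l$-linear maps determined by $\alpha=\epsilon(\alpha)+\sum_j\frac{\partial\alpha}{\partial x_j}(x_j-1)$ ($\epsilon$ the augmentation). The pro-$l$ Gassner cocycle is $\mathrm{Gass}_S(g):=\left((\theta\circ\pi)\left(\frac{\partial\,\mathrm{Ih}_S(g)(x_j)}{\partial x_i}\right)\right)_{i,j}\in\mathrm{GL}(r;\Lambda_r)$. *)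

theory Defs
  imports
    "HOL-Complex_Analysis.Complex_Analysis"
    "HOL-Library.Multiset"
    "HOL-Algebra.Generated_Groups"
    "HOL-Algebra.Generated_Fields"
    "HOL-Algebra.Embedded_Algebras"
    "HOL-Algebra.Algebraic_Closure_Type"
    "HOL-Computational_Algebra.Computational_Algebra"
    "Berlekamp_Zassenhaus.Finite_Field"
begin

section \<open>The ring of l-adic integers\<close>

text \<open>The prime l is the cardinality of a type of class \<^class>\<open>prime_card\<close>. An l-adic integer is
  a compatible sequence of residues, the n-th one being the representative modulo \<open>l ^ n\<close> in
  \<open>{0..<l ^ n}\<close>.\<close>

typedef (overloaded) ('l::prime_card) zl =
  "{a :: nat \<Rightarrow> nat. \<forall>n. a n < CARD('l) ^ n \<and> a (Suc n) mod CARD('l) ^ n = a n}"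
  morphisms zl_res Abs_zl
  by (rule exI[of _ "\<lambda>_. 0"]) auto

setup_lifting type_definition_zl

lemma zl_mod_step: "(x::nat) mod CARD('l::prime_card) ^ Suc n mod CARD('l) ^ n = x mod CARD('l) ^ n"
  by (simp add: mod_mod_cancel)

lemma zl_mod_less: "(x::nat) mod CARD('l::prime_card) ^ n < CARD('l) ^ n"
  by (rule mod_less_divisor) (rule zero_less_power, rule zero_less_card_finite)

instantiation zl :: (prime_card) comm_ring_1
begin

lift_definition zero_zl :: "'a zl" is "\<lambda>_. 0" by simp
lift_definition one_zl :: "'a zl" is "\<lambda>n. 1 mod CARD('a) ^ n"
  by (intro allI conjI zl_mod_less zl_mod_step)
lift_definition plus_zl :: "'a zl \<Rightarrow> 'a zl \<Rightarrow> 'a zl" is "\<lambda>a b n. (a n + b n) mod CARD('a) ^ n"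
  by (simp only: zl_mod_step) (metis mod_add_eq zl_mod_less)
lift_definition times_zl :: "'a zl \<Rightarrow> 'a zl \<Rightarrow> 'a zl" is "\<lambda>a b n. (a n * b n) mod CARD('a) ^ n"
  by (simp only: zl_mod_step) (metis mod_mult_eq zl_mod_less)
lift_definition uminus_zl :: "'a zl \<Rightarrow> 'a zl" is "\<lambda>a n. (CARD('a) ^ n - a n) mod CARD('a) ^ n"
proof -
  fix a :: "nat \<Rightarrow> nat" and n
  let ?q = "CARD('a)"
  assume a: "\<And>n. a n < ?q ^ n \<and> a (Suc n) mod ?q ^ n = a n"
  have "(?q ^ Suc n - a (Suc n) + a n) mod ?q ^ n = (?q ^ Suc n - a (Suc n) + a (Suc n)) mod ?q ^ n"
    using a[of n] by (metis mod_add_right_eq)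
  also have "\<dots> = 0" using a[of "Suc n"] by simp
  also have "0 = (?q ^ n - a n + a n) mod ?q ^ n" using a[of n] by simp
  finally have "[?q ^ Suc n - a (Suc n) + a n = ?q ^ n - a n + a n] (mod ?q ^ n)"
    by (simp add: cong_def)
  hence "[?q ^ Suc n - a (Suc n) = ?q ^ n - a n] (mod ?q ^ n)"
    by (simp only: cong_add_rcancel_nat)
  thus "(?q ^ n - a n) mod ?q ^ n < ?q ^ n \<and>
        (?q ^ Suc n - a (Suc n)) mod ?q ^ Suc n mod ?q ^ n = (?q ^ n - a n) mod ?q ^ n"
    by (simp only: zl_mod_step) (simp add: cong_def)
qed
definition minus_zl :: "'a zl \<Rightarrow> 'a zl \<Rightarrow> 'a zl" where "minus_zl a b = a + - b"

instance
proof
  fix a b c :: "'a zl"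
  show "a * b * c = a * (b * c)"
    by transfer (simp add: fun_eq_iff mod_mult_left_eq mod_mult_right_eq mult.assoc)
  show "a * b = b * a" by transfer (simp add: mult.commute)
  show "1 * a = a"
    by transfer (rule ext, simp only: mod_mult_left_eq mult_1, rule mod_less, blast)
  show "a + b + c = a + (b + c)"
    by transfer (simp add: fun_eq_iff mod_add_left_eq mod_add_right_eq add.assoc)
  show "a + b = b + a" by transfer (simp add: add.commute)
  show "0 + a = a" by transfer simp
  show "- a + a = 0" 
    by transfer (simp add: fun_eq_iff mod_add_left_eq less_imp_le)
  show "a - b = a + - b" by (simp add: minus_zl_def)
  show "(a + b) * c = a * c + b * c"
    by transfer (simp add: fun_eq_iff mod_mult_left_eq mod_add_eq distrib_right)
  show "(0::'a zl) \<noteq> 1"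
  proof
    assume "(0::'a zl) = 1"
    hence "zl_res (0::'a zl) 1 = zl_res (1::'a zl) 1" by simp
    moreover have "CARD('a) > 1" using prime_card[where 'a='a] prime_gt_1_nat by blast
    ultimately show False by (simp add: zero_zl.rep_eq one_zl.rep_eq)
  qed
qed

end

lemma zl_res_mono: "m \<le> n \<Longrightarrow> zl_res (a::'a::prime_card zl) n mod CARD('a) ^ m = zl_res a m"
proof (induction n)
  case 0
  have "zl_res a 0 < CARD('a) ^ 0" using zl_res[of a] by blast
  with 0 show ?case by simp
next
  case (Suc n)
  have st: "zl_res a (Suc n) mod CARD('a) ^ n = zl_res a n" using zl_res[of a] by simp
  show ?case
  proof (cases "m = Suc n")
    case True
    have "zl_res a (Suc n) < CARD('a) ^ Suc n" using zl_res[of a] by blast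
    thus ?thesis unfolding True by (rule mod_less)
  next
    case False
    hence mn: "m \<le> n" using Suc by simp
    have "zl_res a (Suc n) mod CARD('a) ^ m = zl_res a (Suc n) mod CARD('a) ^ n mod CARD('a) ^ m"
      using mn by (simp add: mod_mod_cancel le_imp_power_dvd)
    thus ?thesis using st Suc.IH[OF mn] by simp
  qed
qed

instantiation zl :: (prime_card) t2_space
begin

definition open_zl :: "'a zl set \<Rightarrow> bool" where
  "open_zl U \<longleftrightarrow> (\<forall>a\<in>U. \<exists>n. \<forall>b. zl_res b n = zl_res a n \<longrightarrow> b \<in> U)"

instance
proof
  show "open (UNIV :: 'a zl set)" by (simp add: open_zl_def)
next
  fix U V :: "'a zl set" assume UV: "open U" "open V"
  show "open (U \<inter> V)" unfolding open_zl_def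
  proof
    fix a assume a: "a \<in> U \<inter> V"
    obtain m where m: "\<And>b. zl_res b m = zl_res a m \<Longrightarrow> b \<in> U"
      using UV(1) a unfolding open_zl_def by blast
    obtain n where n: "\<And>b. zl_res b n = zl_res a n \<Longrightarrow> b \<in> V"
      using UV(2) a unfolding open_zl_def by blast
    show "\<exists>n. \<forall>b. zl_res b n = zl_res a n \<longrightarrow> b \<in> U \<inter> V"
    proof (intro exI allI impI)
      fix b :: "'a zl" assume "zl_res b (max m n) = zl_res a (max m n)"
      hence "zl_res b k = zl_res a k" if "k \<le> max m n" for k
        using zl_res_mono[OF that, of a] zl_res_mono[OF that, of b] by metis
      hence "zl_res b m = zl_res a m" "zl_res b n = zl_res a n" by simp_all
      thus "b \<in> U \<inter> V" using m n by blast
    qed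
  qed
next
  fix K :: "'a zl set set" assume K: "\<forall>U\<in>K. open U"
  show "open (\<Union>K)" unfolding open_zl_def
  proof
    fix a assume "a \<in> \<Union>K"
    then obtain U where U: "U \<in> K" "a \<in> U" by blast
    with K obtain n where "\<And>b. zl_res b n = zl_res a n \<Longrightarrow> b \<in> U"
      unfolding open_zl_def by blast
    with U show "\<exists>n. \<forall>b. zl_res b n = zl_res a n \<longrightarrow> b \<in> \<Union>K" by blast
  qed
next
  fix a b :: "'a zl" assume "a \<noteq> b"
  hence "zl_res a \<noteq> zl_res b" by (simp add: zl_res_inject)
  then obtain n where n: "zl_res a n \<noteq> zl_res b n" by blast
  have op: "open {c :: 'a zl. zl_res c n = k}" for k
    unfolding open_zl_def by (intro ballI exI[of _ n] allI impI) simp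
  show "\<exists>U V. open U \<and> open V \<and> a \<in> U \<and> b \<in> V \<and> U \<inter> V = {}"
  proof (intro exI conjI)
    show "open {c :: 'a zl. zl_res c n = zl_res a n}" "open {c :: 'a zl. zl_res c n = zl_res b n}"
      by (fact op)+
    show "{c. zl_res c n = zl_res a n} \<inter> {c. zl_res c n = zl_res b n} = {}" using n by auto
  qed simp_all
qed

end

section \<open>Commutative formal power series\<close>

text \<open>A power series in commuting variables indexed by \<^typ>\<open>nat\<close> is the function sending a monomial,
  that is a multiset of variables, to its coefficient.\<close>

typedef 'a mps = "UNIV :: (nat multiset \<Rightarrow> 'a) set"
  morphisms mps_nth Abs_mps by simp

setup_lifting type_definition_mps

lemma finite_mset_splits: "finite {(a, b). a + b = (m :: 'b multiset)}"
proof -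
  have *: "finite {a. a \<subseteq># m}"
  proof (rule finite_subset)
    show "{a. a \<subseteq># m} \<subseteq> mset ` {xs. set xs \<subseteq> set_mset m \<and> length xs \<le> size m}"
    proof
      fix a assume "a \<in> {a. a \<subseteq># m}"
      moreover obtain xs where "a = mset xs" by (metis ex_mset)
      ultimately show "a \<in> mset ` {xs. set xs \<subseteq> set_mset m \<and> length xs \<le> size m}"
        using set_mset_mono[of a m] size_mset_mono[of a m] by auto
    qed
  qed (simp add: finite_lists_length_le)
  show ?thesis
    by (rule finite_subset[OF _ finite_cartesian_product[OF * *]]) auto
qed

lemma sum_mset_splits_assoc:
  fixes f g h :: "'b multiset \<Rightarrow> 'a::comm_ring_1"
  shows "(\<Sum>(c, d)\<in>{(c, d). c + d = m}. (\<Sum>(a, b)\<in>{(a, b). a + b = c}. f a * g b) * h d) =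
         (\<Sum>(a, e)\<in>{(a, e). a + e = m}. f a * (\<Sum>(b, d)\<in>{(b, d). b + d = e}. g b * h d))"
proof -
  let ?S = "\<lambda>m :: 'b multiset. {(a, b). a + b = m}"
  have "(\<Sum>p\<in>?S m. (\<Sum>q\<in>?S (fst p). f (fst q) * g (snd q)) * h (snd p)) =
        (\<Sum>(p, q)\<in>(SIGMA p:?S m. ?S (fst p)). f (fst q) * g (snd q) * h (snd p))"
    by (simp add: sum_distrib_right sum.Sigma finite_mset_splits)
  also have "\<dots> = (\<Sum>(p, q)\<in>(SIGMA p:?S m. ?S (snd p)). f (fst p) * (g (fst q) * h (snd q)))"
    by (rule sum.reindex_bij_witness
          [where j = "\<lambda>((c, d), (a, b)). ((a, b + d), (b, d))"
             and i = "\<lambda>((a, e), (b, d)). ((a + b, d), (a, b))"])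
       (auto simp: add.assoc mult.assoc)
  also have "\<dots> = (\<Sum>p\<in>?S m. f (fst p) * (\<Sum>q\<in>?S (snd p). g (fst q) * h (snd q)))"
    by (simp add: sum_distrib_left sum.Sigma finite_mset_splits)
  finally show ?thesis by (simp add: case_prod_unfold)
qed

instantiation mps :: (comm_ring_1) comm_ring_1
begin

lift_definition zero_mps :: "'a mps" is "\<lambda>_. 0" .
lift_definition one_mps :: "'a mps" is "\<lambda>m. if m = {#} then 1 else 0" .
lift_definition plus_mps :: "'a mps \<Rightarrow> 'a mps \<Rightarrow> 'a mps" is "\<lambda>f g m. f m + g m" .
lift_definition minus_mps :: "'a mps \<Rightarrow> 'a mps \<Rightarrow> 'a mps" is "\<lambda>f g m. f m - g m" .
lift_definition uminus_mps :: "'a mps \<Rightarrow> 'a mps" is "\<lambda>f m. - f m" .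
lift_definition times_mps :: "'a mps \<Rightarrow> 'a mps \<Rightarrow> 'a mps" is
  "\<lambda>f g m. \<Sum>(a, b)\<in>{(a, b). a + b = m}. f a * g b" .

instance
proof
  fix a b c :: "'a mps"
  show "a * b * c = a * (b * c)" by transfer (simp add: sum_mset_splits_assoc)
  show "a * b = b * a"
  proof transfer
    fix f g :: "nat multiset \<Rightarrow> 'a"
    show "(\<lambda>m. \<Sum>(a, b)\<in>{(a, b). a + b = m}. f a * g b) =
          (\<lambda>m. \<Sum>(a, b)\<in>{(a, b). a + b = m}. g a * f b)"
      by (rule ext, rule sum.reindex_bij_witness[where i = prod.swap and j = prod.swap])
         (auto simp: add.commute mult.commute)
  qed
  show "1 * a = a"
  proof transfer
    fix f :: "nat multiset \<Rightarrow> 'a"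
    have "(\<Sum>p\<in>{(a, b). a + b = m}. (if fst p = {#} then 1 else 0) * f (snd p)) =
          (\<Sum>p\<in>{({#} :: nat multiset, m)}. f (snd p))" for m
      by (rule sum.mono_neutral_cong_right) (auto simp: finite_mset_splits)
    hence "(\<Sum>p\<in>{(a, b). a + b = m}. (if fst p = {#} then 1 else 0) * f (snd p)) = f m" for m
      by simp
    thus "(\<lambda>m. \<Sum>(a, b)\<in>{(a, b). a + b = m}. (if a = {#} then 1 else 0) * f b) = f"
      by (simp add: fun_eq_iff case_prod_unfold)
  qed
  show "(a + b) * c = a * c + b * c"
    by transfer (simp add: fun_eq_iff distrib_right sum.distrib case_prod_unfold)
  show "a + b + c = a + (b + c)" by transfer (simp add: add.assoc)
  show "a + b = b + a" by transfer (simp add: add.commute)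
  show "0 + a = a" by transfer simp
  show "- a + a = 0" by transfer simp
  show "a - b = a + - b" by transfer simp
  show "(0::'a mps) \<noteq> 1" by transfer (metis zero_neq_one)
qed

end

text \<open>The topology of coefficientwise convergence.\<close>

instantiation mps :: (t2_space) t2_space
begin

definition open_mps :: "'a mps set \<Rightarrow> bool" where
  "open_mps U \<longleftrightarrow> open (mps_nth ` U)"

instance
proof
  have surj: "range (mps_nth :: 'a mps \<Rightarrow> _) = UNIV"
    using type_definition.Rep_range[OF type_definition_mps] by blast
  have inj: "inj (mps_nth :: 'a mps \<Rightarrow> _)" by (simp add: inj_def mps_nth_inject)
  show "open (UNIV :: 'a mps set)" by (simp add: open_mps_def surj)
  show "open (U \<inter> V)" if "open U" "open V" for U V :: "'a mps set"
    using that unfolding open_mps_def image_Int[OF inj] by (rule open_Int)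
  show "open (\<Union>K)" if "\<forall>U\<in>K. open U" for K :: "'a mps set set"
    using that unfolding open_mps_def image_Union by blast
  show "\<exists>U V. open U \<and> open V \<and> f \<in> U \<and> g \<in> V \<and> U \<inter> V = {}" if "f \<noteq> g" for f g :: "'a mps"
  proof -
    have "mps_nth f \<noteq> mps_nth g" using that by (simp add: mps_nth_inject)
    then obtain m where "mps_nth f m \<noteq> mps_nth g m" by blast
    then obtain U V where UV: "open U" "open V" "mps_nth f m \<in> U" "mps_nth g m \<in> V" "U \<inter> V = {}"
      using hausdorff[OF \<open>mps_nth f m \<noteq> mps_nth g m\<close>] by blast
    have op: "open (mps_nth ` {h. mps_nth h m \<in> W})" if "open W" for W :: "'a set"
    proof -
      have "mps_nth ` {h. mps_nth h m \<in> W} = (\<lambda>h. h m) -` W"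
      proof (rule equalityI; rule subsetI)
        fix k assume k: "k \<in> (\<lambda>h. h m) -` W"
        obtain h where "k = mps_nth h" using surj by blast
        with k show "k \<in> mps_nth ` {h. mps_nth h m \<in> W}" by blast
      qed blast
      moreover have "open ((\<lambda>h :: nat multiset \<Rightarrow> 'a. h m) -` W)"
        by (rule open_vimage[OF that continuous_on_product_coordinates])
      ultimately show ?thesis by (simp only:)
    qed
    show ?thesis
    proof (intro exI conjI)
      show "open {h. mps_nth h m \<in> U}" "open {h. mps_nth h m \<in> V}"
        using op UV unfolding open_mps_def by blast+
      show "f \<in> {h. mps_nth h m \<in> U}" "g \<in> {h. mps_nth h m \<in> V}" using UV by blast+
      show "{h. mps_nth h m \<in> U} \<inter> {h. mps_nth h m \<in> V} = {}" using UV(5) by blast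
    qed
  qed
qed

end

definition mps_const :: "'a::zero \<Rightarrow> 'a mps" where
  "mps_const c = Abs_mps (\<lambda>m. if m = {#} then c else 0)"

definition mps_var :: "nat \<Rightarrow> 'a::zero_neq_one mps" where
  "mps_var i = Abs_mps (\<lambda>m. if m = {#i#} then 1 else 0)"

text \<open>Exact quotient; the divisor is a variable in all uses, hence not a zero divisor.\<close>

definition mps_quot :: "'a::comm_ring_1 mps \<Rightarrow> 'a mps \<Rightarrow> 'a mps" where
  "mps_quot f h = (THE q. q * h = f)"

text \<open>\<open>x ^ a\<close> for an l-adic exponent \<open>a\<close>.\<close>

definition zl_power :: "'a::{t2_space, monoid_mult} \<Rightarrow> 'l::prime_card zl \<Rightarrow> 'a" where
  "zl_power x a = lim (\<lambda>n. x ^ zl_res a n)"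

section \<open>Pro-l groups\<close>

definition open_normal :: "('g, 'b) monoid_scheme \<Rightarrow> 'g topology \<Rightarrow> 'g set set" where
  "open_normal G T = {N. N \<lhd> G \<and> openin T N}"

definition topological_group :: "('g, 'b) monoid_scheme \<Rightarrow> 'g topology \<Rightarrow> bool" where
  "topological_group G T \<longleftrightarrow> group G \<and> topspace T = carrier G \<and>
     continuous_map (prod_topology T T) T (\<lambda>(a, b). a \<otimes>\<^bsub>G\<^esub> b) \<and>
     continuous_map T T (\<lambda>a. inv\<^bsub>G\<^esub> a)"

definition pro_l_group :: "nat \<Rightarrow> ('g, 'b) monoid_scheme \<Rightarrow> 'g topology \<Rightarrow> bool" where
  "pro_l_group l G T \<longleftrightarrow> topological_group G T \<and>
     compact_space T \<and> Hausdorff_space T \<and>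
     (\<forall>a\<in>topspace T. connected_component_of_set T a = {a}) \<and>
     (\<forall>N\<in>open_normal G T. \<exists>m. order (G Mod N) = l ^ m)"

text \<open>Freeness is the universal property with respect to finite l-groups, which is equivalent to the
  one with respect to all pro-l groups by passing to inverse limits. Up to isomorphism it suffices to
  let the finite groups live on \<^typ>\<open>nat\<close>.\<close>

definition free_pro_l_group ::
  "nat \<Rightarrow> nat \<Rightarrow> ('g, 'b) monoid_scheme \<Rightarrow> 'g topology \<Rightarrow> (nat \<Rightarrow> 'g) \<Rightarrow> bool" where
  "free_pro_l_group l r F T x \<longleftrightarrow> pro_l_group l F T \<and> x \<in> {1..r} \<rightarrow> carrier F \<and>
     (\<forall>(Q :: nat monoid) q. group Q \<longrightarrow> (\<exists>m. order Q = l ^ m) \<longrightarrow> q \<in> {1..r} \<rightarrow> carrier Q \<longrightarrow>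
        (\<exists>!h. h \<in> hom F Q \<and> h \<in> extensional (carrier F) \<and>
              continuous_map T (discrete_topology (carrier Q)) h \<and> (\<forall>i\<in>{1..r}. h (x i) = q i)))"

text \<open>\<open>a ^ c\<close> for an l-adic exponent \<open>c\<close>.\<close>

definition pro_pow :: "('g, 'b) monoid_scheme \<Rightarrow> 'g topology \<Rightarrow> 'g \<Rightarrow> 'l::prime_card zl \<Rightarrow> 'g" where
  "pro_pow G T a c = (THE b. limitin T (\<lambda>n. a [^]\<^bsub>G\<^esub> zl_res c n) b sequentially)"

definition gconj :: "('g, 'b) monoid_scheme \<Rightarrow> 'g \<Rightarrow> 'g \<Rightarrow> 'g" where
  "gconj G h a = h \<otimes>\<^bsub>G\<^esub> a \<otimes>\<^bsub>G\<^esub> inv\<^bsub>G\<^esub> h"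

definition closed_commutator :: "('g, 'b) monoid_scheme \<Rightarrow> 'g topology \<Rightarrow> 'g set" where
  "closed_commutator G T = T closure_of derived G (carrier G)"

definition abz :: "('g, 'b) monoid_scheme \<Rightarrow> 'g topology \<Rightarrow> 'g set monoid" where
  "abz G T = G Mod closed_commutator G T"

definition abz_map :: "('g, 'b) monoid_scheme \<Rightarrow> 'g topology \<Rightarrow> 'g \<Rightarrow> 'g set" where
  "abz_map G T a = closed_commutator G T #>\<^bsub>G\<^esub> a"

definition quotient_topology :: "'g topology \<Rightarrow> ('g \<Rightarrow> 'h) \<Rightarrow> 'h topology" where
  "quotient_topology T f =
     topology (\<lambda>V. V \<subseteq> f ` topspace T \<and> openin T {a \<in> topspace T. f a \<in> V})"

lemma istopology_quotient:
  "istopology (\<lambda>V. V \<subseteq> f ` topspace T \<and> openin T {a \<in> topspace T. f a \<in> V})"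
  unfolding istopology_def
proof (intro conjI allI impI)
  fix U V
  assume "U \<subseteq> f ` topspace T \<and> openin T {a \<in> topspace T. f a \<in> U}"
     and "V \<subseteq> f ` topspace T \<and> openin T {a \<in> topspace T. f a \<in> V}"
  moreover have "{a \<in> topspace T. f a \<in> U \<inter> V} =
      {a \<in> topspace T. f a \<in> U} \<inter> {a \<in> topspace T. f a \<in> V}" by blast
  ultimately show "U \<inter> V \<subseteq> f ` topspace T" "openin T {a \<in> topspace T. f a \<in> U \<inter> V}" by auto
next
  fix \<K>
  assume K: "\<forall>V\<in>\<K>. V \<subseteq> f ` topspace T \<and> openin T {a \<in> topspace T. f a \<in> V}"
  have "{a \<in> topspace T. f a \<in> \<Union>\<K>} = (\<Union>V\<in>\<K>. {a \<in> topspace T. f a \<in> V})" by blast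
  with K show "\<Union>\<K> \<subseteq> f ` topspace T" "openin T {a \<in> topspace T. f a \<in> \<Union>\<K>}"
    by auto
qed

definition abz_top :: "('g, 'b) monoid_scheme \<Rightarrow> 'g topology \<Rightarrow> 'g set topology" where
  "abz_top G T = quotient_topology T (abz_map G T)"

definition top_aut :: "('g, 'b) monoid_scheme \<Rightarrow> 'g topology \<Rightarrow> ('g \<Rightarrow> 'g) set" where
  "top_aut G T = {\<phi> \<in> iso G G. homeomorphic_map T T \<phi>}"

section \<open>Complete group algebras and power series algebras\<close>

text \<open>The complete group algebra of G is the inverse limit, over the open normal subgroups N, of the
  group algebras of \<open>G Mod N\<close> with l-adic coefficients: \<open>\<alpha> N C\<close> is the coefficient at the coset
  \<open>C\<close> of the component of \<open>\<alpha>\<close> at \<open>N\<close>. The coefficients being profinite, it carries the topology of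
  convergence of all coefficients, i.e. the one induced by the product topology of the function space.\<close>

definition cga :: "('g, 'b) monoid_scheme \<Rightarrow> 'g topology \<Rightarrow>
    ('l::prime_card zl, 'g set \<Rightarrow> 'g set \<Rightarrow> 'l zl) module" where
  "cga G T = \<lparr>
     carrier = {\<alpha>. (\<forall>N C. \<not> (N \<in> open_normal G T \<and> C \<in> carrier (G Mod N)) \<longrightarrow> \<alpha> N C = 0) \<and>
                   (\<forall>N\<in>open_normal G T. \<forall>N'\<in>open_normal G T. N \<subseteq> N' \<longrightarrow>
                      (\<forall>C'\<in>carrier (G Mod N').
                         \<alpha> N' C' = (\<Sum>C | C \<in> carrier (G Mod N) \<and> C \<subseteq> C'. \<alpha> N C)))},
     mult = (\<lambda>\<alpha> \<beta> N C. if N \<in> open_normal G T \<and> C \<in> carrier (G Mod N)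
               then \<Sum>A\<in>carrier (G Mod N). \<alpha> N A * \<beta> N (inv\<^bsub>G Mod N\<^esub> A \<otimes>\<^bsub>G Mod N\<^esub> C) else 0),
     one = (\<lambda>N C. if N \<in> open_normal G T \<and> C = N then 1 else 0),
     zero = (\<lambda>N C. 0),
     add = (\<lambda>\<alpha> \<beta> N C. \<alpha> N C + \<beta> N C),
     smult = (\<lambda>c \<alpha> N C. c * \<alpha> N C) \<rparr>"

definition cga_of :: "('g, 'b) monoid_scheme \<Rightarrow> 'g topology \<Rightarrow> 'g \<Rightarrow>
    ('g set \<Rightarrow> 'g set \<Rightarrow> 'l::prime_card zl)" where
  "cga_of G T a = (\<lambda>N C. if N \<in> open_normal G T \<and> C = N #>\<^bsub>G\<^esub> a then 1 else 0)"

text \<open>The augmentation is the component at the open normal subgroup \<open>carrier G\<close>.\<close>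

definition augmentation :: "('g, 'b) monoid_scheme \<Rightarrow>
    ('g set \<Rightarrow> 'g set \<Rightarrow> 'l::prime_card zl) \<Rightarrow> 'l zl" where
  "augmentation G \<alpha> = \<alpha> (carrier G) (carrier G)"

text \<open>The map of complete group algebras induced by the abelianization: for N open normal in the
  abelianization of G, with preimage N' in G, the two quotients \<open>G Mod N'\<close> and \<open>abz G T Mod N\<close>
  are identified by taking preimages.\<close>

definition cga_abz :: "('g, 'b) monoid_scheme \<Rightarrow> 'g topology \<Rightarrow>
    ('g set \<Rightarrow> 'g set \<Rightarrow> 'l::prime_card zl) \<Rightarrow> ('g set set \<Rightarrow> 'g set set \<Rightarrow> 'l zl)" where
  "cga_abz G T \<alpha> =
     (\<lambda>N C. if N \<in> open_normal (abz G T) (abz_top G T) \<and> C \<in> carrier (abz G T Mod N)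
            then \<alpha> {a \<in> carrier G. abz_map G T a \<in> N} {a \<in> carrier G. abz_map G T a \<in> C} else 0)"

text \<open>Power series over the l-adic integers in the non-commuting variables \<open>X\<^sub>1, \<dots>, X\<^sub>r\<close>, as functions
  on words.\<close>

definition ncps :: "nat \<Rightarrow> ('l::prime_card zl, nat list \<Rightarrow> 'l zl) module" where
  "ncps r = \<lparr>
     carrier = {f. \<forall>w. \<not> set w \<subseteq> {1..r} \<longrightarrow> f w = 0},
     mult = (\<lambda>f g w. \<Sum>i\<le>length w. f (take i w) * g (drop i w)),
     one = (\<lambda>w. if w = [] then 1 else 0),
     zero = (\<lambda>w. 0),
     add = (\<lambda>f g w. f w + g w),
     smult = (\<lambda>c f w. c * f w) \<rparr>"

definition ncps_var :: "nat \<Rightarrow> nat list \<Rightarrow> 'l::prime_card zl" where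
  "ncps_var i = (\<lambda>w. if w = [i] then 1 else 0)"

text \<open>The algebra of commutative power series in \<open>u\<^sub>1, \<dots>, u\<^sub>r\<close>.\<close>

definition Lam :: "nat \<Rightarrow> ('l::prime_card zl, 'l zl mps) module" where
  "Lam r = \<lparr>
     carrier = {f. \<forall>m. \<not> set_mset m \<subseteq> {1..r} \<longrightarrow> mps_nth f m = 0},
     mult = (*), one = 1, zero = 0, add = (+),
     smult = (\<lambda>c f. mps_const c * f) \<rparr>"

definition top_alg_iso ::
  "('l::prime_card zl, 'a::topological_space) module \<Rightarrow> ('l zl, 'b::topological_space) module \<Rightarrow>
   ('a \<Rightarrow> 'b) \<Rightarrow> bool" where
  "top_alg_iso A B f \<longleftrightarrow> f \<in> ring_iso A B \<and>
     (\<forall>c. \<forall>\<alpha>\<in>carrier A. f (c \<odot>\<^bsub>A\<^esub> \<alpha>) = c \<odot>\<^bsub>B\<^esub> f \<alpha>) \<and>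
     homeomorphic_map (top_of_set (carrier A)) (top_of_set (carrier B)) f"

definition is_Theta :: "('g, 'b) monoid_scheme \<Rightarrow> 'g topology \<Rightarrow> nat \<Rightarrow> (nat \<Rightarrow> 'g) \<Rightarrow>
    (('g set \<Rightarrow> 'g set \<Rightarrow> 'l::prime_card zl) \<Rightarrow> nat list \<Rightarrow> 'l zl) \<Rightarrow> bool" where
  "is_Theta F T r x \<Theta> \<longleftrightarrow> top_alg_iso (cga F T) (ncps r) \<Theta> \<and>
     (\<forall>i\<in>{1..r}. \<Theta> (cga_of F T (x i)) = \<one>\<^bsub>ncps r\<^esub> \<oplus>\<^bsub>ncps r\<^esub> ncps_var i)"

definition is_theta :: "('g, 'b) monoid_scheme \<Rightarrow> 'g topology \<Rightarrow> nat \<Rightarrow> (nat \<Rightarrow> 'g) \<Rightarrow>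
    (('g set set \<Rightarrow> 'g set set \<Rightarrow> 'l::prime_card zl) \<Rightarrow> 'l zl mps) \<Rightarrow> bool" where
  "is_theta F T r x \<theta> \<longleftrightarrow> top_alg_iso (cga (abz F T) (abz_top F T)) (Lam r) \<theta> \<and>
     (\<forall>i\<in>{1..r}. \<theta> (cga_of (abz F T) (abz_top F T) (abz_map F T (x i))) = 1 + mps_var i)"

definition is_chi_Lambda :: "nat \<Rightarrow> 'l::prime_card zl \<Rightarrow> ('l zl mps \<Rightarrow> 'l zl mps) \<Rightarrow> bool" where
  "is_chi_Lambda r a f \<longleftrightarrow> top_alg_iso (Lam r) (Lam r) f \<and>
     (\<forall>i\<in>{1..r}. f (mps_var i) = zl_power (1 + mps_var i) a - 1)"

definition is_fox :: "('g, 'b) monoid_scheme \<Rightarrow> 'g topology \<Rightarrow> nat \<Rightarrow> (nat \<Rightarrow> 'g) \<Rightarrow>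
    (nat \<Rightarrow> ('g set \<Rightarrow> 'g set \<Rightarrow> 'l::prime_card zl) \<Rightarrow> ('g set \<Rightarrow> 'g set \<Rightarrow> 'l zl)) \<Rightarrow> bool" where
  "is_fox F T r x D \<longleftrightarrow> (let A = cga F T in
     (\<forall>j\<in>{1..r}. D j \<in> carrier A \<rightarrow> carrier A \<and> continuous_on (carrier A) (D j) \<and>
        (\<forall>\<alpha>\<in>carrier A. \<forall>\<beta>\<in>carrier A. D j (\<alpha> \<oplus>\<^bsub>A\<^esub> \<beta>) = D j \<alpha> \<oplus>\<^bsub>A\<^esub> D j \<beta>) \<and>
        (\<forall>c. \<forall>\<alpha>\<in>carrier A. D j (c \<odot>\<^bsub>A\<^esub> \<alpha>) = c \<odot>\<^bsub>A\<^esub> D j \<alpha>)) \<and>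
     (\<forall>\<alpha>\<in>carrier A. \<alpha> = augmentation F \<alpha> \<odot>\<^bsub>A\<^esub> \<one>\<^bsub>A\<^esub> \<oplus>\<^bsub>A\<^esub>
        (\<Oplus>\<^bsub>A\<^esub>j\<in>{1..r}. D j \<alpha> \<otimes>\<^bsub>A\<^esub> (cga_of F T (x j) \<ominus>\<^bsub>A\<^esub> \<one>\<^bsub>A\<^esub>))))"

section \<open>Galois groups and the pro-l fundamental group of a punctured projective line\<close>

text \<open>Automorphisms of a subfield E of a field are normalized to be the identity outside E.\<close>

definition field_auts :: "'a::field set \<Rightarrow> ('a \<Rightarrow> 'a) set" where
  "field_auts E = {\<sigma>. bij_betw \<sigma> E E \<and>
     (\<forall>a\<in>E. \<forall>b\<in>E. \<sigma> (a + b) = \<sigma> a + \<sigma> b \<and> \<sigma> (a * b) = \<sigma> a * \<sigma> b) \<and> (\<forall>a. a \<notin> E \<longrightarrow> \<sigma> a = a)}"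

definition gal :: "'a::field set \<Rightarrow> 'a set \<Rightarrow> ('a \<Rightarrow> 'a) set" where
  "gal E K = {\<sigma> \<in> field_auts E. \<forall>a\<in>K. \<sigma> a = a}"

definition gal_group :: "'a::field set \<Rightarrow> 'a set \<Rightarrow> ('a \<Rightarrow> 'a) monoid" where
  "gal_group E K = \<lparr> carrier = gal E K, mult = (\<circ>), one = id \<rparr>"

definition krull_top :: "'a::field set \<Rightarrow> 'a set \<Rightarrow> ('a \<Rightarrow> 'a) topology" where
  "krull_top E K = subtopology (product_topology (\<lambda>_. discrete_topology UNIV) UNIV) (gal E K)"

abbreviation Qbar :: "complex set" where
  "Qbar \<equiv> {z. algebraic z}"

datatype p1point = Pt complex | Infty

definition marked_points :: "nat \<Rightarrow> (nat \<Rightarrow> p1point) \<Rightarrow> bool" where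
  "marked_points r S \<longleftrightarrow> inj_on S {1..r+1} \<and> (\<forall>z. Pt z \<in> S ` {1..r+1} \<longrightarrow> z \<in> Qbar) \<and>
     S 1 = Pt 0 \<and> S 2 = Pt 1 \<and> S (r + 1) = Infty"

definition base_field :: "nat \<Rightarrow> (nat \<Rightarrow> p1point) \<Rightarrow> complex set" where
  "base_field r S = generate_field ring_of_type_algebra {z. Pt z \<in> S ` {1..r+1}}"

definition cyclotomic :: "(complex \<Rightarrow> complex) \<Rightarrow> 'l::prime_card zl" where
  "cyclotomic g = (THE a. \<forall>n z. z ^ (CARD('l) ^ n) = 1 \<longrightarrow> g z = z ^ zl_res a n)"

text \<open>All function fields are taken inside a fixed algebraic closure of the field of rational functions
  in t over the complex numbers.\<close>

type_synonym falg = "complex poly fract alg_closure"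

definition fconst :: "complex \<Rightarrow> falg" where
  "fconst c = to_ac (to_fract [:c:])"

definition ft :: falg where
  "ft = to_ac (to_fract [:0, 1:])"

text \<open>The field of rational functions over the algebraic numbers.\<close>

definition Qbar_t :: "falg set" where
  "Qbar_t = generate_field ring_of_type_algebra (insert ft (fconst ` Qbar))"

fun uniformizer :: "p1point \<Rightarrow> falg" where
  "uniformizer (Pt z) = ft - fconst z"
| "uniformizer Infty = inverse ft"

definition discrete_valuation :: "'a::field set \<Rightarrow> ('a \<Rightarrow> int) \<Rightarrow> bool" where
  "discrete_valuation L v \<longleftrightarrow> v ` (L - {0}) = UNIV \<and>
     (\<forall>a\<in>L - {0}. \<forall>b\<in>L - {0}. v (a * b) = v a + v b \<and> (a + b \<noteq> 0 \<longrightarrow> min (v a) (v b) \<le> v (a + b)))"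

text \<open>The places of L above P are the normalized valuations that are positive at the uniformizer of P,
  whose value there is the ramification index (residue fields have characteristic 0).\<close>

definition unramified_at :: "falg set \<Rightarrow> p1point \<Rightarrow> bool" where
  "unramified_at L P \<longleftrightarrow>
     (\<forall>v. discrete_valuation L v \<and> v (uniformizer P) > 0 \<longrightarrow> v (uniformizer P) = 1)"

definition finite_galois_l :: "nat \<Rightarrow> falg set \<Rightarrow> bool" where
  "finite_galois_l l L \<longleftrightarrow> subfield L ring_of_type_algebra \<and> Qbar_t \<subseteq> L \<and>
     (\<exists>m. ring.dimension ring_of_type_algebra (l ^ m) Qbar_t L) \<and>
     {f \<in> L. \<forall>\<sigma>\<in>gal L Qbar_t. \<sigma> f = f} = Qbar_t"

text \<open>The maximal pro-l extension of \<^const>\<open>Qbar_t\<close> unramified outside S. Its Galois group is the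
  maximal pro-l quotient of the etale fundamental group of the projective line minus S.\<close>

definition max_pro_l_ext :: "nat \<Rightarrow> p1point set \<Rightarrow> falg set" where
  "max_pro_l_ext l S = \<Union>{L. finite_galois_l l L \<and>
     (\<forall>P. P \<notin> S \<longrightarrow> (\<forall>z. P = Pt z \<longrightarrow> z \<in> Qbar) \<longrightarrow> unramified_at L P)}"

text \<open>The class of a small loop around P, in the Galois group of an extension M of \<^const>\<open>Qbar_t\<close>:
  embed M into the algebraic closure of the field of formal Laurent series in a uniformizer s at P
  (a field of Puiseux series), and restrict to M the monodromy of the counterclockwise
  loop around \<open>s = 0\<close>, which multiplies \<open>s\<^bsup>1/n\<^esup>\<close> by \<open>exp (2 \<pi> \<i> / n)\<close>.
  Different embeddings give conjugate elements.\<close>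

definition small_loop :: "falg set \<Rightarrow> p1point \<Rightarrow> (falg \<Rightarrow> falg) \<Rightarrow> bool" where
  "small_loop M P \<sigma> \<longleftrightarrow> \<sigma> \<in> gal M Qbar_t \<and>
     (\<exists>(\<psi> :: falg \<Rightarrow> complex fls alg_closure) \<tau>.
        (\<forall>a\<in>M. \<forall>b\<in>M. \<psi> (a + b) = \<psi> a + \<psi> b \<and> \<psi> (a * b) = \<psi> a * \<psi> b) \<and>
        (\<forall>c\<in>Qbar. \<psi> (fconst c) = to_ac (fls_const c)) \<and>
        \<psi> (uniformizer P) = to_ac fls_X \<and>
        \<tau> \<in> gal UNIV (range to_ac) \<and>
        (\<forall>n>0. \<forall>s. s ^ n = to_ac fls_X \<longrightarrow> \<tau> s = to_ac (fls_const (cis (2 * pi / real n))) * s) \<and>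
        (\<forall>f\<in>M. \<psi> (\<sigma> f) = \<tau> (\<psi> f)))"

definition x_ext :: "('g, 'b) monoid_scheme \<Rightarrow> nat \<Rightarrow> (nat \<Rightarrow> 'g) \<Rightarrow> nat \<Rightarrow> 'g" where
  "x_ext F r x i =
     (if i = r + 1 then inv\<^bsub>F\<^esub> (foldr (\<lambda>j a. x j \<otimes>\<^bsub>F\<^esub> a) [1..<r+1] \<one>\<^bsub>F\<^esub>) else x i)"

text \<open>An identification of F with the maximal pro-l quotient of the fundamental group.\<close>

definition is_identification :: "nat \<Rightarrow> ('g, 'b) monoid_scheme \<Rightarrow> 'g topology \<Rightarrow> nat \<Rightarrow>
    (nat \<Rightarrow> 'g) \<Rightarrow> (nat \<Rightarrow> p1point) \<Rightarrow> ('g \<Rightarrow> falg \<Rightarrow> falg) \<Rightarrow> bool" where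
  "is_identification l F T r x S \<iota> \<longleftrightarrow> (let M = max_pro_l_ext l (S ` {1..r+1}) in
     \<iota> \<in> iso F (gal_group M Qbar_t) \<and> homeomorphic_map T (krull_top M Qbar_t) \<iota> \<and>
     (\<forall>i\<in>{1..r+1}. small_loop M (S i) (\<iota> (x_ext F r x i))))"

text \<open>The outer automorphism of F given by g, as the set of automorphisms representing it: an
  automorphism g' of the function field M that extends g and fixes t acts on the Galois group of M
  by conjugation, and two choices of g' differ by an element of that group.\<close>

definition outer_action :: "nat \<Rightarrow> ('g, 'b) monoid_scheme \<Rightarrow> 'g topology \<Rightarrow> nat \<Rightarrow>
    (nat \<Rightarrow> p1point) \<Rightarrow> ('g \<Rightarrow> falg \<Rightarrow> falg) \<Rightarrow> (complex \<Rightarrow> complex) \<Rightarrow> ('g \<Rightarrow> 'g) set" where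
  "outer_action l F T r S \<iota> g = (let M = max_pro_l_ext l (S ` {1..r+1}) in
     {\<phi> \<in> top_aut F T. \<exists>g'\<in>field_auts M. g' ft = ft \<and> (\<forall>c\<in>Qbar. g' (fconst c) = fconst (g c)) \<and>
        (\<forall>a\<in>carrier F. \<iota> (\<phi> a) \<circ> g' = g' \<circ> \<iota> a)})"

section \<open>The Ihara representation, longitudes, Milnor numbers, Gassner cocycle\<close>

text \<open>The subgroup generated by the commutator subgroup and some of the generators is understood as a
  closed subgroup. The type argument fixes the prime.\<close>

definition ihara_group :: "'l::prime_card itself \<Rightarrow> ('g, 'b) monoid_scheme \<Rightarrow> 'g topology \<Rightarrow> nat \<Rightarrow>
    (nat \<Rightarrow> 'g) \<Rightarrow> ('g \<Rightarrow> 'g) set" where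
  "ihara_group _ F T r x = {\<phi> \<in> top_aut F T. \<exists>N :: 'l zl. N dvd 1 \<and>
     (\<forall>i\<in>{1..r-1}. \<exists>h\<in>carrier F. \<phi> (x i) = gconj F h (pro_pow F T (x i) N)) \<and>
     (\<exists>h\<in>T closure_of generate F (derived F (carrier F) \<union> x ` {1..r-2}).
        \<phi> (x r) = gconj F h (pro_pow F T (x r) N)) \<and>
     \<phi> (x_ext F r x (r + 1)) = pro_pow F T (x_ext F r x (r + 1)) N}"

definition is_ihara_rep :: "'l::prime_card itself \<Rightarrow> ('g, 'b) monoid_scheme \<Rightarrow> 'g topology \<Rightarrow> nat \<Rightarrow>
    (nat \<Rightarrow> 'g) \<Rightarrow> (nat \<Rightarrow> p1point) \<Rightarrow> ('g \<Rightarrow> falg \<Rightarrow> falg) \<Rightarrow>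
    ((complex \<Rightarrow> complex) \<Rightarrow> 'g \<Rightarrow> 'g) \<Rightarrow> bool" where
  "is_ihara_rep l F T r x S \<iota> Ih \<longleftrightarrow>
     (\<forall>g\<in>gal Qbar (base_field r S).
        Ih g \<in> ihara_group l F T r x \<and> Ih g \<in> outer_action CARD('l) F T r S \<iota> g)"

text \<open>The coefficient of \<open>X\<^sub>i\<close> in the class of \<open>a\<close> in the abelianization, a free module over the
  l-adic integers (written multiplicatively) on the classes of \<open>x\<^sub>1, \<dots>, x\<^sub>r\<close>, equals \<open>c\<close>.\<close>

definition has_ab_coeff :: "('g, 'b) monoid_scheme \<Rightarrow> 'g topology \<Rightarrow> nat \<Rightarrow> (nat \<Rightarrow> 'g) \<Rightarrow>
    'g \<Rightarrow> nat \<Rightarrow> 'l::prime_card zl \<Rightarrow> bool" where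
  "has_ab_coeff F T r x a i c \<longleftrightarrow> (\<exists>e :: nat \<Rightarrow> 'l zl. e i = c \<and>
     abz_map F T a = (\<Otimes>\<^bsub>abz F T\<^esub>j\<in>{1..r}. pro_pow (abz F T) (abz_top F T) (abz_map F T (x j)) (e j)))"

definition is_longitudes :: "'l::prime_card itself \<Rightarrow> ('g, 'b) monoid_scheme \<Rightarrow> 'g topology \<Rightarrow> nat \<Rightarrow>
    (nat \<Rightarrow> 'g) \<Rightarrow> (nat \<Rightarrow> p1point) \<Rightarrow> ((complex \<Rightarrow> complex) \<Rightarrow> 'g \<Rightarrow> 'g) \<Rightarrow>
    (nat \<Rightarrow> (complex \<Rightarrow> complex) \<Rightarrow> 'g) \<Rightarrow> bool" where
  "is_longitudes _ F T r x S Ih y \<longleftrightarrow> (\<forall>g\<in>gal Qbar (base_field r S). \<forall>i\<in>{1..r}.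
     y i g \<in> carrier F \<and>
     Ih g (x i) = gconj F (y i g) (pro_pow F T (x i) (cyclotomic g :: 'l zl)) \<and>
     has_ab_coeff F T r x (y i g) i (0 :: 'l zl))"

definition magnus_coeff :: "('g, 'b) monoid_scheme \<Rightarrow> 'g topology \<Rightarrow>
    (('g set \<Rightarrow> 'g set \<Rightarrow> 'l::prime_card zl) \<Rightarrow> nat list \<Rightarrow> 'l zl) \<Rightarrow> nat list \<Rightarrow> 'g \<Rightarrow> 'l zl" where
  "magnus_coeff F T \<Theta> J a = \<Theta> (cga_of F T a) J"

definition milnor :: "('g, 'b) monoid_scheme \<Rightarrow> 'g topology \<Rightarrow>
    (('g set \<Rightarrow> 'g set \<Rightarrow> 'l::prime_card zl) \<Rightarrow> nat list \<Rightarrow> 'l zl) \<Rightarrow>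
    (nat \<Rightarrow> (complex \<Rightarrow> complex) \<Rightarrow> 'g) \<Rightarrow> (complex \<Rightarrow> complex) \<Rightarrow> nat list \<Rightarrow> 'l zl" where
  "milnor F T \<Theta> y g I =
     (if length I \<ge> 2 then magnus_coeff F T \<Theta> (butlast I) (y (last I) g) else 0)"

definition gassner :: "('g, 'b) monoid_scheme \<Rightarrow> 'g topology \<Rightarrow> (nat \<Rightarrow> 'g) \<Rightarrow>
    ((complex \<Rightarrow> complex) \<Rightarrow> 'g \<Rightarrow> 'g) \<Rightarrow>
    (nat \<Rightarrow> ('g set \<Rightarrow> 'g set \<Rightarrow> 'l::prime_card zl) \<Rightarrow> ('g set \<Rightarrow> 'g set \<Rightarrow> 'l zl)) \<Rightarrow>
    (('g set set \<Rightarrow> 'g set set \<Rightarrow> 'l zl) \<Rightarrow> 'l zl mps) \<Rightarrow>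
    (complex \<Rightarrow> complex) \<Rightarrow> nat \<Rightarrow> nat \<Rightarrow> 'l zl mps" where
  "gassner F T x Ih D \<theta> g i j = \<theta> (cga_abz F T (D i (cga_of F T (Ih g (x j)))))"

definition words :: "nat \<Rightarrow> nat \<Rightarrow> nat list set" where
  "words r n = {w. length w = n \<and> set w \<subseteq> {1..r}}"

definition mono_u :: "nat list \<Rightarrow> 'a::comm_ring_1 mps" where
  "mono_u w = prod_list (map mps_var w)"

end

theory Submission
  imports Defs
begin

text \<open>Let \<open>c\<close> be the cyclotomic value of \<open>g\<close>, let \<open>y\<close> be the longitude \<open>y\<^sub>j(g)\<close> and let \<open>p\<close> be the power of
  \<open>x\<^sub>j\<close> with exponent \<open>c\<close>; then \<open>g\<close> sends \<open>x\<^sub>j\<close> to the conjugate of \<open>p\<close> by \<open>y\<close>. Write \<open>a(h)\<close> for the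
  image of a group element \<open>h\<close> in the commutative power series ring, and \<open>d\<^sub>i(h)\<close> for that of its \<open>i\<close>-th
  Fox derivative. The product rule gives (\<open>fox_ab_gconj\<close>) that the entry of the Gassner matrix is
  \<open>(1 - a(p)) d\<^sub>i(y) + a(y) d\<^sub>i(p)\<close>. Here \<open>a(p) - 1 = (1 + u\<^sub>j)\<^sup>c - 1\<close> is the value at \<open>u\<^sub>j\<close> of the
  automorphism attached to \<open>g\<close>, and \<open>d\<^sub>i(p)\<close> is 0 for \<open>i \<noteq> j\<close> and \<open>(a(p) - 1) / u\<^sub>j\<close> for \<open>i = j\<close>. Off the
  diagonal this is a multiple of \<open>d\<^sub>i(y)\<close>. On the diagonal one inserts the fundamental formula
  \<open>a(y) = 1 + \<Sum>\<^sub>k d\<^sub>k(y) u\<^sub>k\<close>: the summand \<open>k = i\<close> cancels, and the quotient times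
  \<open>1 + \<Sum>\<^sub>k d\<^sub>k(y) u\<^sub>k\<close> remains, with \<open>k\<close> running over the indices other than \<open>i\<close> (\<open>fox_ab_conj_x\<close>).

  Milnor numbers enter through two facts on the Magnus expansion. The \<open>k\<close>-th Fox derivative has at
  the word \<open>w\<close> the coefficient of the original element at \<open>w\<close> followed by \<open>k\<close> (\<open>Theta_D\<close>). The image in the
  commutative ring arises from the Magnus expansion by letting the variables commute
  (\<open>mps_nth_ab\<close>); this follows from the fundamental formula by induction on the degree. Together they
  write \<open>d\<^sub>k(y)\<close>, and the partial sums of the fundamental formula, as the series of the theorem
  (\<open>fox_ab_series\<close>, \<open>fox_ab_partial_series\<close>).

  What remains is to make these manipulations legitimate. The complete group algebra has to be
  closed under its operations, the map induced by the abelianization has to respect them, and the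
  l-adic power \<open>p\<close> has to be an actual limit of ordinary powers (\<open>limitin_pro_pow\<close>), since its image
  and its derivatives are computed from those of the ordinary powers by continuity.\<close>

section \<open>Topological groups and l-adic powers in pro-l groups\<close>

(* With an implicit structure, "closure_of" could also be read as the closure in a setoid; here it
   always is the topological closure. *)
no_notation eq_closure_of ("closure'_of\<index>")

locale top_group =
  fixes G :: "('g, 'b) monoid_scheme" (structure) and T :: "'g topology"
  assumes top_group: "topological_group G T"

sublocale top_group \<subseteq> group G
  using top_group by (simp add: topological_group_def)

context top_group
begin

lemma topspace_eq [simp]: "topspace T = carrier G"
  using top_group by (simp add: topological_group_def)

lemma continuous_map_mult:
  assumes "continuous_map Y T f" and "continuous_map Y T h"
  shows "continuous_map Y T (\<lambda>z. f z \<otimes> h z)"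
proof -
  have "continuous_map Y T ((\<lambda>(a, b). a \<otimes> b) \<circ> (\<lambda>z. (f z, h z)))"
    using top_group assms
    by (intro continuous_map_compose[of _ "prod_topology T T"])
       (auto simp: topological_group_def continuous_map_paired)
  then show ?thesis by (simp add: o_def)
qed

lemma continuous_map_inverse: "continuous_map T T (\<lambda>a. inv a)"
  using top_group by (simp add: topological_group_def)

lemma continuous_map_translate_right: "c \<in> carrier G \<Longrightarrow> continuous_map T T (\<lambda>a. a \<otimes> c)"
  by (rule continuous_map_mult) auto

lemma openin_rcoset:
  assumes "openin T N" and a: "a \<in> carrier G"
  shows "openin T (N #> a)"
proof -
  have N: "N \<subseteq> carrier G" using assms(1) openin_subset by fastforce
  have "N #> a = {b \<in> topspace T. b \<otimes> inv a \<in> N}"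
  proof (intro equalityI subsetI)
    fix b assume "b \<in> N #> a"
    then obtain n where "n \<in> N" "b = n \<otimes> a" by (auto simp: r_coset_def)
    then show "b \<in> {b \<in> topspace T. b \<otimes> inv a \<in> N}" using a N by (auto simp: m_assoc)
  next
    fix b assume b: "b \<in> {b \<in> topspace T. b \<otimes> inv a \<in> N}"
    then have "b = (b \<otimes> inv a) \<otimes> a" using a by (simp add: m_assoc)
    then show "b \<in> N #> a" using b unfolding r_coset_def by blast
  qed
  then show ?thesis
    using openin_continuous_map_preimage[OF continuous_map_translate_right assms(1), of "inv a"] a
    by simp
qed

lemma closure_of_subset_carrier: "T closure_of A \<subseteq> carrier G"
  using closure_of_subset_topspace[of T A] by simp

lemma closure_of_subgroup:
  assumes "subgroup A G"
  shows "subgroup (T closure_of A) G"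
proof
  have A: "A \<subseteq> T closure_of A"
    using subgroup.subset[OF assms] by (intro closure_of_subset) simp
  show "T closure_of A \<subseteq> carrier G" by (rule closure_of_subset_carrier)
  show "\<one> \<in> T closure_of A" using A subgroup.one_closed[OF assms] by blast
  show "inv a \<in> T closure_of A" if "a \<in> T closure_of A" for a
  proof -
    have "inv a \<in> T closure_of ((\<lambda>a. inv a) ` A)"
      using continuous_map_image_closure_subset[OF continuous_map_inverse] that by blast
    also have "\<dots> \<subseteq> T closure_of A"
      using subgroup.m_inv_closed[OF assms] by (intro closure_of_mono) blast
    finally show ?thesis .
  qed
  show "a \<otimes> b \<in> T closure_of A" if "a \<in> T closure_of A" "b \<in> T closure_of A" for a b
  proof -
    have "continuous_map (prod_topology T T) T (\<lambda>(a, b). a \<otimes> b)"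
      using top_group by (simp add: topological_group_def)
    from continuous_map_image_closure_subset[OF this, of "A \<times> A"]
    have "a \<otimes> b \<in> T closure_of ((\<lambda>(a, b). a \<otimes> b) ` (A \<times> A))"
      using that by (auto simp: closure_of_Times)
    also have "\<dots> \<subseteq> T closure_of A"
      using subgroup.m_closed[OF assms] by (intro closure_of_mono) auto
    finally show ?thesis .
  qed
qed

lemma closure_of_normal:
  assumes "A \<lhd> G"
  shows "T closure_of A \<lhd> G"
  unfolding normal_inv_iff
proof (intro conjI ballI)
  show "subgroup (T closure_of A) G"
    using assms normal_imp_subgroup closure_of_subgroup by blast
  fix a h assume a: "a \<in> carrier G" and h: "h \<in> T closure_of A"
  have "continuous_map T T (\<lambda>b. a \<otimes> b \<otimes> inv a)"
    using a by (intro continuous_map_mult) auto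
  from continuous_map_image_closure_subset[OF this, of A]
  have "a \<otimes> h \<otimes> inv a \<in> T closure_of ((\<lambda>b. a \<otimes> b \<otimes> inv a) ` A)"
    using h by blast
  also have "\<dots> \<subseteq> T closure_of A"
    using assms a unfolding normal_inv_iff by (intro closure_of_mono) blast
  finally show "a \<otimes> h \<otimes> inv a \<in> T closure_of A" .
qed

lemma closed_commutator_normal: "closed_commutator G T \<lhd> G"
  unfolding closed_commutator_def by (intro closure_of_normal derived_self_is_normal)

lemma group_abz: "group (abz G T)"
  unfolding abz_def using closed_commutator_normal by (rule normal.factorgroup_is_group)

lemma abz_map_hom: "group_hom G (abz G T) (abz_map G T)"
proof -
  have "(\<lambda>a. closed_commutator G T #> a) \<in> hom G (abz G T)"
    unfolding abz_def using closed_commutator_normal by (rule normal.r_coset_hom_Mod)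
  then show ?thesis
    using group_abz is_group by (simp add: group_hom_def group_hom_axioms_def abz_map_def[abs_def])
qed

lemma abz_map_surj: "abz_map G T ` carrier G = carrier (abz G T)"
  by (auto simp: abz_def abz_map_def FactGroup_def RCOSETS_def)

text \<open>The component of an element of the complete group algebra of the abelianization at \<open>N\<close> is read
  off at this preimage of \<open>N\<close>, so the preimage has to be one of the subgroups over which the limit
  defining the complete group algebra of \<open>G\<close> is taken.\<close>

lemma vimage_open_normal:
  assumes "N \<in> open_normal (abz G T) (abz_top G T)"
  shows "{a \<in> carrier G. abz_map G T a \<in> N} \<in> open_normal G T"
proof -
  interpret h: group_hom G "abz G T" "abz_map G T" by (rule abz_map_hom)
  have N: "N \<lhd> abz G T" "openin (abz_top G T) N"
    using assms by (auto simp: open_normal_def)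
  then interpret N: normal N "abz G T" by simp
  have "openin T {a \<in> carrier G. abz_map G T a \<in> N}"
    using N(2) topology_inverse'[OF istopology_quotient[of "abz_map G T" T]]
    by (simp add: abz_top_def quotient_topology_def)
  moreover have "{a \<in> carrier G. abz_map G T a \<in> N} \<lhd> G"
    unfolding normal_inv_iff using N.inv_op_closed2
    by (auto intro!: subgroupI intro: exI[of _ \<one>])
  ultimately show ?thesis by (simp add: open_normal_def)
qed

lemma carrier_open_normal: "carrier G \<in> open_normal G T"
  using openin_topspace[of T] by (simp add: open_normal_def normal_self)

end

locale pro_l_top_group = top_group G T
  for G :: "('g, 'b) monoid_scheme" (structure) and T :: "'g topology" +
  fixes l :: nat
  assumes l_pos: "0 < l" and pro_l: "pro_l_group l G T"
begin

lemma compact: "compact_space T" and Hausdorff: "Hausdorff_space T"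
  using pro_l by (auto simp: pro_l_group_def)

lemma order_quotient: "N \<in> open_normal G T \<Longrightarrow> \<exists>m. order (G Mod N) = l ^ m"
  using pro_l by (auto simp: pro_l_group_def)

lemma finite_quotient:
  assumes "N \<in> open_normal G T" shows "finite (carrier (G Mod N))"
proof -
  obtain m where "order (G Mod N) = l ^ m" using order_quotient[OF assms] by blast
  then have "card (carrier (G Mod N)) > 0" using l_pos by (simp add: order_def)
  then show ?thesis by (rule card_ge_0_finite)
qed

text \<open>Take the elements that can be inserted anywhere into a product without changing its membership in
  \<open>U\<close>. The condition is two-sided, so they form a subgroup that is even normal. The
  exceptional elements are the projection of a closed set of triples along a compact factor, so the subgroup is open.\<close>

lemma clopen_contains_open_normal:
  assumes cl: "closedin T U" and op: "openin T U" and one: "\<one> \<in> U"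
  shows "\<exists>N\<in>open_normal G T. N \<subseteq> U"
proof -
  let ?N = "{h \<in> carrier G. \<forall>a\<in>carrier G. \<forall>b\<in>carrier G. a \<otimes> h \<otimes> b \<in> U \<longleftrightarrow> a \<otimes> b \<in> U}"
  have "subgroup ?N G"
  proof (rule subgroupI)
    show "?N \<noteq> {}" by (auto intro!: exI[of _ \<one>])
    fix h assume h: "h \<in> ?N"
    show "inv h \<in> ?N"
    proof (intro CollectI conjI ballI)
      fix a b assume ab: "a \<in> carrier G" "b \<in> carrier G"
      have "a \<otimes> h \<otimes> (inv h \<otimes> b) \<in> U \<longleftrightarrow> a \<otimes> (inv h \<otimes> b) \<in> U"
        using h ab by blast
      moreover have "a \<otimes> h \<otimes> (inv h \<otimes> b) = a \<otimes> b"
        using h ab by (metis (no_types, lifting) inv_closed m_assoc m_closed mem_Collect_eq r_inv r_one)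
      ultimately show "a \<otimes> inv h \<otimes> b \<in> U \<longleftrightarrow> a \<otimes> b \<in> U"
        using h ab by (simp add: m_assoc)
    qed (use h in auto)
    fix h' assume h': "h' \<in> ?N"
    show "h \<otimes> h' \<in> ?N"
    proof (intro CollectI conjI ballI)
      fix a b assume ab: "a \<in> carrier G" "b \<in> carrier G"
      have "a \<otimes> (h \<otimes> h') \<otimes> b = a \<otimes> h \<otimes> (h' \<otimes> b)" using h h' ab by (simp add: m_assoc)
      also have "\<dots> \<in> U \<longleftrightarrow> a \<otimes> (h' \<otimes> b) \<in> U" using h h' ab by blast
      also have "a \<otimes> (h' \<otimes> b) = a \<otimes> h' \<otimes> b" using h' ab by (simp add: m_assoc)
      finally show "a \<otimes> (h \<otimes> h') \<otimes> b \<in> U \<longleftrightarrow> a \<otimes> b \<in> U" using h' ab by blast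
    qed (use h h' in auto)
  qed auto
  moreover have "c \<otimes> h \<otimes> inv c \<in> ?N" if c: "c \<in> carrier G" and h: "h \<in> ?N" for c h
  proof (intro CollectI conjI ballI)
    fix a b assume ab: "a \<in> carrier G" "b \<in> carrier G"
    have "a \<otimes> (c \<otimes> h \<otimes> inv c) \<otimes> b = (a \<otimes> c) \<otimes> h \<otimes> (inv c \<otimes> b)"
      using c h ab by (simp add: m_assoc)
    also have "\<dots> \<in> U \<longleftrightarrow> (a \<otimes> c) \<otimes> (inv c \<otimes> b) \<in> U" using c h ab by blast
    also have "(a \<otimes> c) \<otimes> (inv c \<otimes> b) = a \<otimes> b"
      using c ab by (metis inv_closed m_assoc m_closed r_inv r_one)
    finally show "a \<otimes> (c \<otimes> h \<otimes> inv c) \<otimes> b \<in> U \<longleftrightarrow> a \<otimes> b \<in> U" .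
  qed (use c h in auto)
  ultimately have normal: "?N \<lhd> G" unfolding normal_inv_iff by blast
  have "openin T ?N"
  proof -
    let ?P = "prod_topology T (prod_topology T T)"
    let ?f = "\<lambda>(h, a, b). a \<otimes> h \<otimes> b" and ?g = "\<lambda>(h, a, b). a \<otimes> b"
    have proj: "continuous_map ?P T (\<lambda>z. fst z)" "continuous_map ?P T (\<lambda>z. fst (snd z))"
      "continuous_map ?P T (\<lambda>z. snd (snd z))"
      using continuous_map_fst[of T "prod_topology T T"]
        continuous_map_compose[OF continuous_map_snd continuous_map_fst, of T T T]
        continuous_map_compose[OF continuous_map_snd continuous_map_snd, of T T T]
      by (simp_all add: o_def)
    have f: "continuous_map ?P T ?f" and g: "continuous_map ?P T ?g"
      unfolding case_prod_unfold by (intro continuous_map_mult proj)+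
    have clo: "closedin ?P {z \<in> topspace ?P. k z \<in> V}"
      if "closedin T V" "continuous_map ?P T k" for k V
      using that by (rule closedin_continuous_map_preimage[rotated])
    have cV: "closedin T (topspace T - U)" using op by blast
    \<comment> \<open>The witnesses against membership: on them the clopen set separates \<open>a h b\<close> from \<open>a b\<close>.\<close>
    define B where "B = {z \<in> topspace ?P. ?f z \<in> U} \<inter> {z \<in> topspace ?P. ?g z \<in> topspace T - U} \<union>
              {z \<in> topspace ?P. ?f z \<in> topspace T - U} \<inter> {z \<in> topspace ?P. ?g z \<in> U}"
    have "closedin ?P B"
      unfolding B_def by (intro closedin_Un closedin_Int clo f g cl cV)
    then have "closedin T (fst ` B)"
      using Abstract_Topological_Spaces.closed_map_fst[of "prod_topology T T" T] compact
      by (auto simp: compact_space_prod_topology closed_map_def)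
    moreover have "?N = topspace T - fst ` B"
    proof -
      have B: "(h, a, b) \<in> B \<longleftrightarrow> h \<in> carrier G \<and> a \<in> carrier G \<and> b \<in> carrier G \<and>
          (a \<otimes> h \<otimes> b \<in> U) \<noteq> (a \<otimes> b \<in> U)" for h a b
        unfolding B_def by auto
      have "h \<in> fst ` B \<longleftrightarrow> (\<exists>a b. (h, a, b) \<in> B)" for h
        unfolding image_iff by (metis fst_conv prod.collapse)
      then show ?thesis unfolding B topspace_eq by blast
    qed
    ultimately show ?thesis by (simp only: openin_diff openin_topspace)
  qed
  moreover have "?N \<subseteq> U"
  proof
    fix h assume h: "h \<in> ?N"
    then have "\<one> \<otimes> h \<otimes> \<one> \<in> U \<longleftrightarrow> \<one> \<otimes> \<one> \<in> U" by blast
    then show "h \<in> U" using h one by simp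
  qed
  ultimately show ?thesis using normal unfolding open_normal_def by blast
qed

text \<open>In a compact Hausdorff space connected components are intersections of clopen sets, so total
  disconnectedness separates \<open>a\<close> from the unit by a clopen set.\<close>

lemma open_normal_separates:
  assumes a: "a \<in> carrier G" and "a \<noteq> \<one>"
  shows "\<exists>N\<in>open_normal G T. a \<notin> N"
proof -
  have "\<not> connected_component_of T \<one> a"
    using pro_l assms by (auto simp: pro_l_group_def)
  then have "\<not> quasi_component_of T \<one> a"
    using quasi_eq_connected_component_of[of T \<one>] compact Hausdorff by simp
  then obtain U where "\<one> \<in> U" "closedin T U" "openin T U" "a \<notin> U"
    using a by (auto simp: quasi_component_of)
  then show ?thesis using clopen_contains_open_normal by blast
qed

lemma open_normal_eqI:
  assumes a: "a \<in> carrier G" and b: "b \<in> carrier G"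
    and eq: "\<And>N. N \<in> open_normal G T \<Longrightarrow> N #> a = N #> b"
  shows "a = b"
proof (rule ccontr)
  assume "a \<noteq> b"
  then have "a \<otimes> inv b \<noteq> \<one>" using a b by (metis inv_equality inv_inv inv_closed)
  then obtain N where N: "N \<in> open_normal G T" "a \<otimes> inv b \<notin> N"
    using open_normal_separates[of "a \<otimes> inv b"] a b by auto
  then have sub: "subgroup N G" by (auto simp: open_normal_def normal_imp_subgroup)
  have "a \<in> N #> b" using eq[OF N(1)] rcos_self[OF a sub] by simp
  then have "a \<otimes> inv b \<in> N"
    using b subgroup.subset[OF sub] by (auto simp: r_coset_def m_assoc)
  then show False using N by blast
qed

text \<open>By compactness the sequence has an accumulation point. Any two accumulation points agree modulo
  every open normal subgroup and hence are equal, and in a compact space a sequence with only one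
  accumulation point converges to it.\<close>

lemma limit_exists:
  assumes s: "\<And>n. s n \<in> carrier G"
    and cauchy: "\<And>N. N \<in> open_normal G T \<Longrightarrow> \<exists>m. \<forall>n\<ge>m. N #> s n = N #> s m"
  shows "\<exists>b. limitin T s b sequentially"
proof -
  define K where "K n = T closure_of (s ` {n..})" for n
  have K: "closedin T (K n)" for n by (simp add: K_def)
  have sK: "s m \<in> K n" if "n \<le> m" for m n
    using that s closure_of_subset[of "s ` {n..}" T] by (auto simp: K_def)
  have dec: "decseq K"
    unfolding decseq_def K_def by (intro allI impI closure_of_mono) auto
  have "(\<Inter>n. K n) \<noteq> {}"
    using sK by (intro compact_space_imp_nest[OF compact K _ dec]) blast
  then obtain b where b: "\<And>n. b \<in> K n" by blast
  have coset: "N #> c = N #> s m"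
    if N: "N \<in> open_normal G T" and m: "\<forall>n\<ge>m. N #> s n = N #> s m" and c: "c \<in> K m" for N m c
  proof -
    have sub: "subgroup N G" and op: "openin T N"
      using N by (auto simp: open_normal_def normal_imp_subgroup)
    have cG: "c \<in> carrier G" using c closure_of_subset_carrier by (auto simp: K_def)
    have "openin T (N #> c)" "c \<in> N #> c"
      using op cG sub by (auto intro: openin_rcoset rcos_self)
    then obtain n where "n \<ge> m" "s n \<in> N #> c"
      using c unfolding K_def in_closure_of by blast
    then show ?thesis using repr_independence[OF _ cG sub] m by metis
  qed
  have uniq: "c = b" if c: "\<And>n. c \<in> K n" for c
  proof (rule open_normal_eqI)
    show "c \<in> carrier G" "b \<in> carrier G"
      using b c closure_of_subset_carrier by (auto simp: K_def)
    fix N assume N: "N \<in> open_normal G T"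
    with cauchy obtain m where "\<forall>n\<ge>m. N #> s n = N #> s m" by blast
    then show "N #> c = N #> b" using coset[OF N] b c by metis
  qed
  have "limitin T s b sequentially"
    unfolding limitin_sequentially
  proof (intro conjI allI impI)
    show "b \<in> topspace T" using b[of 0] closure_of_subset_carrier by (auto simp: K_def)
    fix V assume V: "openin T V \<and> b \<in> V"
    show "\<exists>m. \<forall>n\<ge>m. s n \<in> V"
    proof (rule ccontr)
      assume *: "\<not> ?thesis"
      \<comment> \<open>Otherwise the tails accumulate outside \<open>V\<close>, away from the only accumulation point.\<close>
      have "(\<Inter>n. K n - V) \<noteq> {}"
      proof (rule compact_space_imp_nest[OF compact])
        show "closedin T (K n - V)" for n using V K by blast
        show "K n - V \<noteq> {}" for n using * sK by blast
        show "decseq (\<lambda>n. K n - V)" using dec unfolding decseq_def by blast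
      qed
      then obtain c where "\<And>n. c \<in> K n" "c \<notin> V" by blast
      then show False using uniq V by blast
    qed
  qed
  then show ?thesis by blast
qed

lemma limit_coset:
  assumes lim: "limitin T s b sequentially" and N: "N \<in> open_normal G T"
  shows "\<exists>m. \<forall>n\<ge>m. N #> s n = N #> b"
proof -
  have sub: "subgroup N G" and op: "openin T N"
    using N by (auto simp: open_normal_def normal_imp_subgroup)
  have b: "b \<in> carrier G" using lim by (simp add: limitin_def)
  then have "openin T (N #> b)" "b \<in> N #> b"
    using op sub by (auto intro: openin_rcoset rcos_self)
  then obtain m where "\<forall>n\<ge>m. s n \<in> N #> b"
    using lim unfolding limitin_sequentially by blast
  then show ?thesis using repr_independence[OF _ b sub] by blast
qed

end

lemma zl_res_cong: "m \<le> n \<Longrightarrow> \<exists>k. zl_res c n = zl_res (c :: 'l::prime_card zl) m + CARD('l) ^ m * k"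
  using zl_res_mono[of m n c] by (metis add.commute mult_div_mod_eq)

text \<open>The residues of \<open>c\<close> modulo \<open>l ^ n\<close> and \<open>l ^ m\<close> differ by a multiple of \<open>l ^ m\<close>, which kills a
  quotient of order \<open>l ^ m\<close>; hence the powers are eventually constant in every finite quotient.\<close>

lemma (in pro_l_top_group) limitin_pro_pow:
  fixes c :: "'l::prime_card zl"
  assumes l: "l = CARD('l)" and a: "a \<in> carrier G"
  shows "limitin T (\<lambda>n. a [^] zl_res c n) (pro_pow G T a c) sequentially"
proof -
  let ?s = "\<lambda>n. a [^] zl_res c n"
  have "\<exists>b. limitin T ?s b sequentially"
  proof (rule limit_exists)
    show "?s n \<in> carrier G" for n using a by simp
    fix N assume N: "N \<in> open_normal G T"
    then interpret N: normal N G by (simp add: open_normal_def)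
    interpret Q: group "G Mod N" by (rule N.factorgroup_is_group)
    obtain m where m: "order (G Mod N) = l ^ m" using order_quotient[OF N] by blast
    have Na: "N #> a \<in> carrier (G Mod N)" using a by (auto simp: FactGroup_def RCOSETS_def)
    have "N #> ?s n = N #> ?s m" if mn: "n \<ge> m" for n
    proof -
      obtain k where k: "zl_res c n = zl_res c m + l ^ m * k" using zl_res_cong[OF mn] l by blast
      have "N #> ?s n = (N #> a) [^]\<^bsub>G Mod N\<^esub> (zl_res c m + l ^ m * k)"
        using a by (simp add: N.FactGroup_pow k)
      also have "\<dots> = (N #> a) [^]\<^bsub>G Mod N\<^esub> zl_res c m \<otimes>\<^bsub>G Mod N\<^esub>
          ((N #> a) [^]\<^bsub>G Mod N\<^esub> (l ^ m)) [^]\<^bsub>G Mod N\<^esub> k"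
        using Na by (simp del: mult_FactGroup add: Q.nat_pow_mult Q.nat_pow_pow)
      also have "\<dots> = (N #> a) [^]\<^bsub>G Mod N\<^esub> zl_res c m"
        using Q.pow_order_eq_1[OF Na] Na by (simp del: mult_FactGroup one_FactGroup add: m)
      finally show ?thesis using a by (simp add: N.FactGroup_pow)
    qed
    then show "\<exists>m. \<forall>n\<ge>m. N #> ?s n = N #> ?s m" by blast
  qed
  then obtain b where b: "limitin T ?s b sequentially" by blast
  moreover have "pro_pow G T a c = b"
    unfolding pro_pow_def using b
    by (rule the_equality) (rule limitin_Hausdorff_unique[OF _ b trivial_limit_sequentially Hausdorff])
  ultimately show ?thesis by simp
qed

section \<open>The complete group algebra\<close>

text \<open>Group algebras are functorial: summing over the fibres of a homomorphism turns the convolution of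
  \<open>Q\<close> into that of \<open>Q'\<close>. This makes the componentwise product of two compatible families
  compatible.\<close>

lemma pushforward_convolution:
  fixes \<alpha> :: "'a \<Rightarrow> 'c::comm_ring_1"
  assumes hom: "group_hom Q Q' f" and fin: "finite (carrier Q)" "finite (carrier Q')"
    and C': "C' \<in> carrier Q'"
  shows "(\<Sum>C | C \<in> carrier Q \<and> f C = C'. \<Sum>A\<in>carrier Q. \<alpha> A * \<beta> (inv\<^bsub>Q\<^esub> A \<otimes>\<^bsub>Q\<^esub> C)) =
    (\<Sum>A'\<in>carrier Q'. (\<Sum>A | A \<in> carrier Q \<and> f A = A'. \<alpha> A) *
       (\<Sum>B | B \<in> carrier Q \<and> f B = inv\<^bsub>Q'\<^esub> A' \<otimes>\<^bsub>Q'\<^esub> C'. \<beta> B))"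
proof -
  interpret group_hom Q Q' f by (rule hom)
  let ?S = "\<lambda>A'. \<Sum>B | B \<in> carrier Q \<and> f B = inv\<^bsub>Q'\<^esub> A' \<otimes>\<^bsub>Q'\<^esub> C'. \<beta> B"
  have "(\<Sum>C | C \<in> carrier Q \<and> f C = C'. \<Sum>A\<in>carrier Q. \<alpha> A * \<beta> (inv\<^bsub>Q\<^esub> A \<otimes>\<^bsub>Q\<^esub> C)) =
      (\<Sum>A\<in>carrier Q. \<Sum>C | C \<in> carrier Q \<and> f C = C'. \<alpha> A * \<beta> (inv\<^bsub>Q\<^esub> A \<otimes>\<^bsub>Q\<^esub> C))"
    by (rule sum.swap)
  also have "\<dots> = (\<Sum>A\<in>carrier Q. \<alpha> A * ?S (f A))"
  proof (rule sum.cong[OF refl])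
    fix A assume A: "A \<in> carrier Q"
    have "(\<Sum>C | C \<in> carrier Q \<and> f C = C'. \<alpha> A * \<beta> (inv\<^bsub>Q\<^esub> A \<otimes>\<^bsub>Q\<^esub> C)) =
        (\<Sum>B | B \<in> carrier Q \<and> f B = inv\<^bsub>Q'\<^esub> f A \<otimes>\<^bsub>Q'\<^esub> C'. \<alpha> A * \<beta> B)"
      using A C'
      by (intro sum.reindex_bij_witness[where i = "\<lambda>B. A \<otimes>\<^bsub>Q\<^esub> B" and j = "\<lambda>C. inv\<^bsub>Q\<^esub> A \<otimes>\<^bsub>Q\<^esub> C"])
         (auto simp: G.m_assoc[symmetric] H.m_assoc[symmetric])
    then show "(\<Sum>C | C \<in> carrier Q \<and> f C = C'. \<alpha> A * \<beta> (inv\<^bsub>Q\<^esub> A \<otimes>\<^bsub>Q\<^esub> C)) = \<alpha> A * ?S (f A)"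
      by (simp add: sum_distrib_left)
  qed
  also have "\<dots> = (\<Sum>A'\<in>carrier Q'. \<Sum>A | A \<in> carrier Q \<and> f A = A'. \<alpha> A * ?S (f A))"
    by (rule sum.group[symmetric]) (use fin in auto)
  also have "\<dots> = (\<Sum>A'\<in>carrier Q'. \<Sum>A | A \<in> carrier Q \<and> f A = A'. \<alpha> A * ?S A')"
    by (intro sum.cong refl) auto
  also have "\<dots> = (\<Sum>A'\<in>carrier Q'. (\<Sum>A | A \<in> carrier Q \<and> f A = A'. \<alpha> A) * ?S A')"
    by (simp add: sum_distrib_right)
  finally show ?thesis .
qed

lemma carrier_Mod_iff: "C \<in> carrier (G Mod N) \<longleftrightarrow> (\<exists>a\<in>carrier G. C = N #>\<^bsub>G\<^esub> a)"
  by (auto simp: FactGroup_def RCOSETS_def)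

context group
begin

lemma rcoset_subset_iff:
  assumes "subgroup N G" "subgroup N' G" "N \<subseteq> N'" and a: "a \<in> carrier G" and C': "C' \<in> carrier (G Mod N')"
  shows "N #> a \<subseteq> C' \<longleftrightarrow> C' = N' #> a"
proof
  assume "N #> a \<subseteq> C'"
  then have "a \<in> C'" using rcos_self[OF a assms(1)] by blast
  then show "C' = N' #> a"
    using C' assms(2) repr_independence unfolding carrier_Mod_iff by blast
next
  assume "C' = N' #> a" then show "N #> a \<subseteq> C'" using assms(3) by (auto simp: r_coset_def)
qed

text \<open>The relation \<open>C \<subseteq> C'\<close> used to compare levels of the complete group algebra is the graph of the
  projection between the two quotients, here written as multiplication by the larger subgroup.\<close>

lemma Mod_projection:
  assumes N: "N \<lhd> G" and N': "N' \<lhd> G" and sub: "N \<subseteq> N'"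
  shows "group_hom (G Mod N) (G Mod N') (\<lambda>C. N' <#> C)"
    and "\<And>a. a \<in> carrier G \<Longrightarrow> N' <#> (N #> a) = N' #> a"
    and "\<And>C C'. C \<in> carrier (G Mod N) \<Longrightarrow> C' \<in> carrier (G Mod N') \<Longrightarrow> C \<subseteq> C' \<longleftrightarrow> N' <#> C = C'"
proof -
  interpret N: normal N G by (rule N)
  interpret N': normal N' G by (rule N')
  show proj: "N' <#> (N #> a) = N' #> a" if "a \<in> carrier G" for a
  proof -
    have "N' <#> (N #> a) = (N' <#> N) #> a"
      using that N'.subset N.subset by (simp add: setmult_rcos_assoc)
    also have "N' <#> N = N'"
    proof
      show "N' <#> N \<subseteq> N'" using sub by (auto simp: set_mult_def)
      show "N' \<subseteq> N' <#> N"
      proof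
        fix n assume n: "n \<in> N'"
        then have "n = n \<otimes> \<one>" using N'.subset by auto
        with n show "n \<in> N' <#> N" unfolding set_mult_def using N.one_closed by blast
      qed
    qed
    finally show ?thesis .
  qed
  have "(\<lambda>C. N' <#> C) \<in> hom (G Mod N) (G Mod N')"
    by (auto simp: hom_def carrier_Mod_iff[of _ G N] proj N.rcos_sum N'.rcos_sum)
       (auto simp: carrier_Mod_iff)
  then show "group_hom (G Mod N) (G Mod N') (\<lambda>C. N' <#> C)"
    by (simp add: group_hom_def group_hom_axioms_def N.factorgroup_is_group N'.factorgroup_is_group)
  show "C \<subseteq> C' \<longleftrightarrow> N' <#> C = C'" if "C \<in> carrier (G Mod N)" "C' \<in> carrier (G Mod N')" for C C'
    using that rcoset_subset_iff[OF N.subgroup_axioms N'.subgroup_axioms sub _ that(2)] proj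
    unfolding carrier_Mod_iff[of C G N] by auto
qed

end

lemma cga_carrierI:
  assumes "\<And>N C. \<not> (N \<in> open_normal G T \<and> C \<in> carrier (G Mod N)) \<Longrightarrow> \<alpha> N C = 0"
    and "\<And>N N' C'. N \<in> open_normal G T \<Longrightarrow> N' \<in> open_normal G T \<Longrightarrow> N \<subseteq> N' \<Longrightarrow>
      C' \<in> carrier (G Mod N') \<Longrightarrow> \<alpha> N' C' = (\<Sum>C | C \<in> carrier (G Mod N) \<and> C \<subseteq> C'. \<alpha> N C)"
  shows "\<alpha> \<in> carrier (cga G T)"
  unfolding cga_def using assms(1) by (auto intro: assms(2))

lemma cga_outside:
  "\<alpha> \<in> carrier (cga G T) \<Longrightarrow> \<not> (N \<in> open_normal G T \<and> C \<in> carrier (G Mod N)) \<Longrightarrow> \<alpha> N C = 0"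
  by (simp add: cga_def)

lemma cga_compatible:
  "\<alpha> \<in> carrier (cga G T) \<Longrightarrow> N \<in> open_normal G T \<Longrightarrow> N' \<in> open_normal G T \<Longrightarrow> N \<subseteq> N' \<Longrightarrow>
    C' \<in> carrier (G Mod N') \<Longrightarrow> \<alpha> N' C' = (\<Sum>C | C \<in> carrier (G Mod N) \<and> C \<subseteq> C'. \<alpha> N C)"
  by (simp add: cga_def)

lemma cga_ops:
  "\<alpha> \<oplus>\<^bsub>cga G T\<^esub> \<beta> = (\<lambda>N C. \<alpha> N C + \<beta> N C)"
  "c \<odot>\<^bsub>cga G T\<^esub> \<alpha> = (\<lambda>N C. c * \<alpha> N C)"
  "\<zero>\<^bsub>cga G T\<^esub> = (\<lambda>N C. 0)"
  by (simp_all add: cga_def)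

lemma cga_mult:
  "(\<alpha> \<otimes>\<^bsub>cga G T\<^esub> \<beta>) N C = (if N \<in> open_normal G T \<and> C \<in> carrier (G Mod N)
     then \<Sum>A\<in>carrier (G Mod N). \<alpha> N A * \<beta> N (inv\<^bsub>G Mod N\<^esub> A \<otimes>\<^bsub>G Mod N\<^esub> C) else 0)"
  by (simp add: cga_def)

lemma cga_abelian_group:
  "abelian_group (cga G T :: ('c::prime_card zl, 'a set \<Rightarrow> 'a set \<Rightarrow> 'c zl) module)"
proof (rule abelian_groupI)
  fix \<alpha> \<beta> :: "'a set \<Rightarrow> 'a set \<Rightarrow> 'c zl"
  assume \<alpha>: "\<alpha> \<in> carrier (cga G T)" and \<beta>: "\<beta> \<in> carrier (cga G T)"
  show "\<alpha> \<oplus>\<^bsub>cga G T\<^esub> \<beta> \<in> carrier (cga G T)"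
  proof (rule cga_carrierI)
    fix N N' C'
    assume *: "N \<in> open_normal G T" "N' \<in> open_normal G T" "N \<subseteq> N'" "C' \<in> carrier (G Mod N')"
    show "(\<alpha> \<oplus>\<^bsub>cga G T\<^esub> \<beta>) N' C' =
        (\<Sum>C | C \<in> carrier (G Mod N) \<and> C \<subseteq> C'. (\<alpha> \<oplus>\<^bsub>cga G T\<^esub> \<beta>) N C)"
      using cga_compatible[OF \<alpha> *] cga_compatible[OF \<beta> *] by (simp add: cga_ops sum.distrib)
  qed (use cga_outside[OF \<alpha>] cga_outside[OF \<beta>] in \<open>simp add: cga_ops\<close>)
  have "(\<lambda>N C. - \<alpha> N C) \<in> carrier (cga G T)"
  proof (rule cga_carrierI)
    fix N N' C'
    assume *: "N \<in> open_normal G T" "N' \<in> open_normal G T" "N \<subseteq> N'" "C' \<in> carrier (G Mod N')"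
    show "- \<alpha> N' C' = (\<Sum>C | C \<in> carrier (G Mod N) \<and> C \<subseteq> C'. - \<alpha> N C)"
      using cga_compatible[OF \<alpha> *] by (simp add: sum_negf)
  qed (use cga_outside[OF \<alpha>] in simp)
  then show "\<exists>\<beta>\<in>carrier (cga G T). \<beta> \<oplus>\<^bsub>cga G T\<^esub> \<alpha> = \<zero>\<^bsub>cga G T\<^esub>"
    by (intro bexI[of _ "\<lambda>N C. - \<alpha> N C"]) (simp_all add: cga_ops)
qed (auto simp: cga_ops fun_eq_iff ac_simps intro!: cga_carrierI)

lemma cga_smult_closed:
  assumes \<alpha>: "\<alpha> \<in> carrier (cga G T)" shows "c \<odot>\<^bsub>cga G T\<^esub> \<alpha> \<in> carrier (cga G T)"
proof (rule cga_carrierI)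
  fix N N' C'
  assume *: "N \<in> open_normal G T" "N' \<in> open_normal G T" "N \<subseteq> N'" "C' \<in> carrier (G Mod N')"
  show "(c \<odot>\<^bsub>cga G T\<^esub> \<alpha>) N' C' = (\<Sum>C | C \<in> carrier (G Mod N) \<and> C \<subseteq> C'. (c \<odot>\<^bsub>cga G T\<^esub> \<alpha>) N C)"
    using cga_compatible[OF \<alpha> *] by (simp add: cga_ops sum_distrib_left)
qed (use cga_outside[OF \<alpha>] in \<open>simp add: cga_ops\<close>)

text \<open>The next three lemmas push additive maps through the operations of an abelian group given by a
  carrier into an abelian group given by a type class; power series and their coefficients are of
  the second kind.\<close>

lemma (in abelian_group) additive_zero:
  fixes h :: "'a \<Rightarrow> 'c::ab_group_add"
  assumes "\<And>a b. a \<in> carrier G \<Longrightarrow> b \<in> carrier G \<Longrightarrow> h (a \<oplus> b) = h a + h b"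
  shows "h \<zero> = 0"
  using assms[of \<zero> \<zero>] by simp

lemma (in abelian_group) additive_finsum:
  fixes h :: "'a \<Rightarrow> 'c::ab_group_add"
  assumes h: "\<And>a b. a \<in> carrier G \<Longrightarrow> b \<in> carrier G \<Longrightarrow> h (a \<oplus> b) = h a + h b"
    and "finite J" and "f \<in> J \<rightarrow> carrier G"
  shows "h (\<Oplus>j\<in>J. f j) = (\<Sum>j\<in>J. h (f j))"
  using assms(2,3)
proof (induction J)
  case empty then show ?case using additive_zero[of h, OF h] by simp
next
  case (insert j J) then show ?case by (simp add: finsum_insert h Pi_def)
qed

lemma (in abelian_group) additive_minus:
  fixes h :: "'a \<Rightarrow> 'c::ab_group_add"
  assumes h: "\<And>a b. a \<in> carrier G \<Longrightarrow> b \<in> carrier G \<Longrightarrow> h (a \<oplus> b) = h a + h b"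
    and a: "a \<in> carrier G" and b: "b \<in> carrier G"
  shows "h (a \<ominus> b) = h a - h b"
proof -
  have "h (a \<ominus> b) + h b = h (a \<ominus> b \<oplus> b)" using a b by (simp add: h)
  also have "a \<ominus> b \<oplus> b = a" using a b by (simp add: a_minus_def a_assoc l_neg)
  finally show ?thesis by (simp add: algebra_simps)
qed

context pro_l_top_group
begin

lemma cga_mult_closed:
  fixes \<alpha> \<beta> :: "'g set \<Rightarrow> 'g set \<Rightarrow> 'c::prime_card zl"
  assumes \<alpha>: "\<alpha> \<in> carrier (cga G T)" and \<beta>: "\<beta> \<in> carrier (cga G T)"
  shows "\<alpha> \<otimes>\<^bsub>cga G T\<^esub> \<beta> \<in> carrier (cga G T)"
proof (rule cga_carrierI)
  fix N N' C'
  assume N: "N \<in> open_normal G T" and N': "N' \<in> open_normal G T" and sub: "N \<subseteq> N'"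
    and C': "C' \<in> carrier (G Mod N')"
  let ?p = "\<lambda>C. N' <#> C"
  have n: "N \<lhd> G" "N' \<lhd> G" using N N' by (auto simp: open_normal_def)
  interpret p: group_hom "G Mod N" "G Mod N'" ?p using Mod_projection(1)[OF n sub] .
  have fib: "{C \<in> carrier (G Mod N). C \<subseteq> D} = {C \<in> carrier (G Mod N). ?p C = D}"
    if "D \<in> carrier (G Mod N')" for D
    using Mod_projection(3)[OF n sub _ that] by blast
  have push: "\<gamma> N' D = (\<Sum>C | C \<in> carrier (G Mod N) \<and> ?p C = D. \<gamma> N C)"
    if "\<gamma> \<in> carrier (cga G T)" "D \<in> carrier (G Mod N')" for \<gamma> :: "'g set \<Rightarrow> 'g set \<Rightarrow> 'c zl" and D
    using cga_compatible[OF that(1) N N' sub that(2)] fib[OF that(2)] by simp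
  have "(\<Sum>C | C \<in> carrier (G Mod N) \<and> C \<subseteq> C'. (\<alpha> \<otimes>\<^bsub>cga G T\<^esub> \<beta>) N C) =
      (\<Sum>C | C \<in> carrier (G Mod N) \<and> ?p C = C'.
         \<Sum>A\<in>carrier (G Mod N). \<alpha> N A * \<beta> N (inv\<^bsub>G Mod N\<^esub> A \<otimes>\<^bsub>G Mod N\<^esub> C))"
    unfolding fib[OF C'] using N by (intro sum.cong) (auto simp del: mult_FactGroup simp: cga_mult)
  also have "\<dots> = (\<Sum>A'\<in>carrier (G Mod N'). (\<Sum>A | A \<in> carrier (G Mod N) \<and> ?p A = A'. \<alpha> N A) *
       (\<Sum>B | B \<in> carrier (G Mod N) \<and> ?p B = inv\<^bsub>G Mod N'\<^esub> A' \<otimes>\<^bsub>G Mod N'\<^esub> C'. \<beta> N B))"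
    by (rule pushforward_convolution[OF p.group_hom_axioms finite_quotient[OF N] finite_quotient[OF N'] C'])
  also have "\<dots> = (\<alpha> \<otimes>\<^bsub>cga G T\<^esub> \<beta>) N' C'"
    using N' C' push[OF \<alpha>] push[OF \<beta>]
    by (simp del: mult_FactGroup add: cga_mult cong: sum.cong)
  finally show "(\<alpha> \<otimes>\<^bsub>cga G T\<^esub> \<beta>) N' C' =
      (\<Sum>C | C \<in> carrier (G Mod N) \<and> C \<subseteq> C'. (\<alpha> \<otimes>\<^bsub>cga G T\<^esub> \<beta>) N C)" by simp
qed (auto simp: cga_mult)

lemma cga_of_closed:
  assumes a: "a \<in> carrier G"
  shows "(cga_of G T a :: 'g set \<Rightarrow> 'g set \<Rightarrow> 'c::prime_card zl) \<in> carrier (cga G T)"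
proof (rule cga_carrierI)
  fix N C assume "\<not> (N \<in> open_normal G T \<and> C \<in> carrier (G Mod N))"
  then show "cga_of G T a N C = (0 :: 'c zl)" using a by (auto simp: cga_of_def carrier_Mod_iff)
next
  fix N N' C'
  assume N: "N \<in> open_normal G T" and N': "N' \<in> open_normal G T" and sub: "N \<subseteq> N'"
    and C': "C' \<in> carrier (G Mod N')"
  have s: "subgroup N G" "subgroup N' G" using N N' by (auto simp: open_normal_def normal_imp_subgroup)
  have Na: "N #> a \<in> carrier (G Mod N)" using a by (auto simp: carrier_Mod_iff)
  have "(\<Sum>C | C \<in> carrier (G Mod N) \<and> C \<subseteq> C'. cga_of G T a N C :: 'c zl) =
      (\<Sum>C | C \<in> carrier (G Mod N) \<and> C \<subseteq> C'. if C = N #> a then 1 else 0)"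
    using N by (simp add: cga_of_def)
  also have "\<dots> = (if N #> a \<subseteq> C' then 1 else 0)"
    using finite_quotient[OF N] Na by simp
  also have "\<dots> = cga_of G T a N' C'"
    using rcoset_subset_iff[OF s sub a C'] N' by (simp add: cga_of_def)
  finally show "cga_of G T a N' C' = (\<Sum>C | C \<in> carrier (G Mod N) \<and> C \<subseteq> C'. cga_of G T a N C :: 'c zl)"
    by simp
qed

lemma cga_of_mult:
  assumes a: "a \<in> carrier G" and b: "b \<in> carrier G"
  shows "cga_of G T a \<otimes>\<^bsub>cga G T\<^esub> cga_of G T b =
    (cga_of G T (a \<otimes> b) :: 'g set \<Rightarrow> 'g set \<Rightarrow> 'c::prime_card zl)"
proof (intro ext)
  fix N C
  show "(cga_of G T a \<otimes>\<^bsub>cga G T\<^esub> cga_of G T b) N C = (cga_of G T (a \<otimes> b) N C :: 'c zl)"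
  proof (cases "N \<in> open_normal G T \<and> C \<in> carrier (G Mod N)")
    case True
    then interpret N: normal N G by (simp add: open_normal_def)
    interpret Q: group "G Mod N" by (rule N.factorgroup_is_group)
    have Na: "N #> a \<in> carrier (G Mod N)" and Nb: "N #> b \<in> carrier (G Mod N)"
      using a b by (auto simp: carrier_Mod_iff)
    have ab: "N #> (a \<otimes> b) = (N #> a) \<otimes>\<^bsub>G Mod N\<^esub> (N #> b)" using a b by (simp add: N.rcos_sum)
    have "(cga_of G T a \<otimes>\<^bsub>cga G T\<^esub> cga_of G T b) N C =
        (\<Sum>A\<in>carrier (G Mod N). if A = N #> a then
           (if inv\<^bsub>G Mod N\<^esub> A \<otimes>\<^bsub>G Mod N\<^esub> C = N #> b then 1 else 0) else 0 :: 'c zl)"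
      using True by (auto simp del: mult_FactGroup simp: cga_mult cga_of_def intro!: sum.cong)
    also have "\<dots> = (if inv\<^bsub>G Mod N\<^esub> (N #> a) \<otimes>\<^bsub>G Mod N\<^esub> C = N #> b then 1 else 0)"
      using finite_quotient Na True by (simp del: mult_FactGroup)
    also have "inv\<^bsub>G Mod N\<^esub> (N #> a) \<otimes>\<^bsub>G Mod N\<^esub> C = N #> b \<longleftrightarrow> C = N #> (a \<otimes> b)"
      unfolding ab using Q.inv_solve_left'[of "N #> b" "N #> a" C] Na Nb True by blast
    finally show ?thesis using True by (simp add: cga_of_def)
  next
    case False
    then show ?thesis
      using cga_outside[OF cga_of_closed[of "a \<otimes> b"]] a b by (auto simp: cga_mult)
  qed
qed

lemma cga_of_one: "cga_of G T \<one> = \<one>\<^bsub>cga G T\<^esub>"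
proof -
  have "N #> \<one> = N" if "N \<in> open_normal G T" for N
    using that normal_imp_subgroup by (auto simp: open_normal_def intro!: coset_mult_one subgroup.subset)
  then show ?thesis by (auto simp: cga_of_def cga_def fun_eq_iff)
qed

lemma augmentation_cga_of: "a \<in> carrier G \<Longrightarrow> augmentation G (cga_of G T a) = 1"
  using carrier_open_normal coset_join2[OF _ subgroup_self]
  by (simp add: augmentation_def cga_of_def)

end

section \<open>The map of complete group algebras induced by the abelianization\<close>

definition hom_vimage :: "('a, 'c) monoid_scheme \<Rightarrow> ('a \<Rightarrow> 'b) \<Rightarrow> 'b set \<Rightarrow> 'a set" where
  "hom_vimage G h Y = {a \<in> carrier G. h a \<in> Y}"

lemma hom_vimage_subset_iff:
  "h ` carrier G = S \<Longrightarrow> Y \<subseteq> S \<Longrightarrow> hom_vimage G h Y \<subseteq> hom_vimage G h Z \<longleftrightarrow> Y \<subseteq> Z"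
  by (auto simp: hom_vimage_def)

lemma (in group_hom) hom_vimage_rcoset:
  assumes N: "subgroup N H" and a: "a \<in> carrier G"
  shows "hom_vimage G h (N #>\<^bsub>H\<^esub> h a) = hom_vimage G h N #> a"
proof (intro equalityI subsetI)
  fix b assume "b \<in> hom_vimage G h (N #>\<^bsub>H\<^esub> h a)"
  then obtain n where b: "b \<in> carrier G" and n: "n \<in> N" "h b = n \<otimes>\<^bsub>H\<^esub> h a"
    by (auto simp: hom_vimage_def r_coset_def)
  then have "h (b \<otimes> inv a) = n"
    using a subgroup.mem_carrier[OF N] by (simp add: H.m_assoc)
  then have "b \<otimes> inv a \<in> hom_vimage G h N" using n a b by (simp add: hom_vimage_def)
  moreover have "b = b \<otimes> inv a \<otimes> a" using a b by (simp add: G.m_assoc)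
  ultimately show "b \<in> hom_vimage G h N #> a" unfolding r_coset_def by blast
qed (use a in \<open>auto simp: hom_vimage_def r_coset_def\<close>)

text \<open>The isomorphism is directed from the quotient of the image to the quotient of the source, because
  in this direction components of elements of complete group algebras are pulled back.\<close>

lemma (in group_hom) hom_vimage_Mod_iso:
  assumes surj: "h ` carrier G = carrier H" and N: "N \<lhd> H" and N': "hom_vimage G h N \<lhd> G"
  shows "group_hom (H Mod N) (G Mod hom_vimage G h N) (hom_vimage G h)"
    and "bij_betw (hom_vimage G h) (carrier (H Mod N)) (carrier (G Mod hom_vimage G h N))"
proof -
  let ?P = "hom_vimage G h"
  interpret N: normal N H by (rule N)
  interpret N': normal "?P N" G by (rule N')
  note rc = hom_vimage_rcoset[OF N.subgroup_axioms]
  have car: "C \<in> carrier (H Mod N) \<longleftrightarrow> (\<exists>a\<in>carrier G. C = N #>\<^bsub>H\<^esub> h a)" for C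
    unfolding carrier_Mod_iff surj[symmetric] by simp
  have "?P \<in> hom (H Mod N) (G Mod ?P N)"
  proof (rule homI)
    fix C assume "C \<in> carrier (H Mod N)"
    then show "?P C \<in> carrier (G Mod ?P N)" unfolding car using rc carrier_Mod_iff by blast
    fix C' assume "C' \<in> carrier (H Mod N)"
    with \<open>C \<in> carrier (H Mod N)\<close> obtain a b
      where ab: "a \<in> carrier G" "b \<in> carrier G" and C: "C = N #>\<^bsub>H\<^esub> h a" "C' = N #>\<^bsub>H\<^esub> h b"
      unfolding car by blast
    have "C <#>\<^bsub>H\<^esub> C' = N #>\<^bsub>H\<^esub> h (a \<otimes> b)" using ab by (simp add: C N.rcos_sum)
    then show "?P (C \<otimes>\<^bsub>H Mod N\<^esub> C') = ?P C \<otimes>\<^bsub>G Mod ?P N\<^esub> ?P C'"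
      using ab rc[of "a \<otimes> b"] by (simp add: C rc N'.rcos_sum)
  qed
  then show "group_hom (H Mod N) (G Mod ?P N) ?P"
    by (simp add: group_hom_def group_hom_axioms_def N.factorgroup_is_group N'.factorgroup_is_group)
  show "bij_betw ?P (carrier (H Mod N)) (carrier (G Mod ?P N))"
    unfolding bij_betw_def
  proof
    have "C \<subseteq> carrier H" if "C \<in> carrier (H Mod N)" for C
      using that N.rcosets_carrier by (simp add: FactGroup_def)
    then show "inj_on ?P (carrier (H Mod N))"
      using hom_vimage_subset_iff[OF surj] by (intro inj_onI) (metis order_refl subset_antisym)
    show "?P ` carrier (H Mod N) = carrier (G Mod ?P N)"
    proof (intro equalityI subsetI)
      fix B assume "B \<in> ?P ` carrier (H Mod N)"
      then obtain C where "C \<in> carrier (H Mod N)" "B = ?P C" by blast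
      then obtain a where "a \<in> carrier G" "B = ?P N #> a" unfolding car using rc by auto
      then show "B \<in> carrier (G Mod ?P N)" unfolding carrier_Mod_iff by blast
    next
      fix B assume "B \<in> carrier (G Mod ?P N)"
      then obtain a where "a \<in> carrier G" "B = ?P (N #>\<^bsub>H\<^esub> h a)"
        unfolding carrier_Mod_iff using rc by auto
      then show "B \<in> ?P ` carrier (H Mod N)" using car by blast
    qed
  qed
qed

lemma cga_abz_eq:
  "cga_abz G T \<alpha> N C = (if N \<in> open_normal (abz G T) (abz_top G T) \<and> C \<in> carrier (abz G T Mod N)
    then \<alpha> (hom_vimage G (abz_map G T) N) (hom_vimage G (abz_map G T) C) else 0)"
  by (simp add: cga_abz_def hom_vimage_def)

lemma cga_abz_add:
  "cga_abz G T (\<alpha> \<oplus>\<^bsub>cga G T\<^esub> \<beta>) =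
    cga_abz G T \<alpha> \<oplus>\<^bsub>cga (abz G T) (abz_top G T)\<^esub> cga_abz G T \<beta>"
  by (auto simp: cga_abz_eq cga_ops fun_eq_iff)

lemma cga_abz_smult:
  "cga_abz G T (c \<odot>\<^bsub>cga G T\<^esub> \<alpha>) = c \<odot>\<^bsub>cga (abz G T) (abz_top G T)\<^esub> cga_abz G T \<alpha>"
  by (auto simp: cga_abz_eq cga_ops fun_eq_iff)

context pro_l_top_group
begin

abbreviation (input) "ab_vimage \<equiv> hom_vimage G (abz_map G T)"

lemma ab_vimage_Mod:
  assumes N: "N \<in> open_normal (abz G T) (abz_top G T)"
  shows "ab_vimage N \<in> open_normal G T"
    and "group_hom (abz G T Mod N) (G Mod ab_vimage N) ab_vimage"
    and "bij_betw ab_vimage (carrier (abz G T Mod N)) (carrier (G Mod ab_vimage N))"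
proof -
  interpret h: group_hom G "abz G T" "abz_map G T" by (rule abz_map_hom)
  show N': "ab_vimage N \<in> open_normal G T"
    unfolding hom_vimage_def by (rule vimage_open_normal[OF N])
  show "group_hom (abz G T Mod N) (G Mod ab_vimage N) ab_vimage"
    "bij_betw ab_vimage (carrier (abz G T Mod N)) (carrier (G Mod ab_vimage N))"
    using h.hom_vimage_Mod_iso[OF abz_map_surj] N N' by (auto simp: open_normal_def)
qed

lemma cga_abz_closed:
  fixes \<alpha> :: "'g set \<Rightarrow> 'g set \<Rightarrow> 'c::prime_card zl"
  assumes \<alpha>: "\<alpha> \<in> carrier (cga G T)"
  shows "cga_abz G T \<alpha> \<in> carrier (cga (abz G T) (abz_top G T))"
proof (rule cga_carrierI)
  fix N N' C'
  assume N: "N \<in> open_normal (abz G T) (abz_top G T)" and N': "N' \<in> open_normal (abz G T) (abz_top G T)"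
    and sub: "N \<subseteq> N'" and C': "C' \<in> carrier (abz G T Mod N')"
  note n = ab_vimage_Mod[OF N] and n' = ab_vimage_Mod[OF N']
  have sub': "ab_vimage N \<subseteq> ab_vimage N'" using sub by (auto simp: hom_vimage_def)
  have cos: "C \<subseteq> carrier (abz G T)" if "C \<in> carrier (abz G T Mod N)" for C
  proof -
    interpret N: normal N "abz G T" using N by (simp add: open_normal_def)
    show ?thesis using that N.rcosets_carrier by (simp add: FactGroup_def)
  qed
  have C'': "ab_vimage C' \<in> carrier (G Mod ab_vimage N')" using n'(3) C' by (rule bij_betw_apply)
  have "cga_abz G T \<alpha> N' C' = (\<Sum>B | B \<in> carrier (G Mod ab_vimage N) \<and> B \<subseteq> ab_vimage C'. \<alpha> (ab_vimage N) B)"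
    using N' C' cga_compatible[OF \<alpha> n(1) n'(1) sub' C''] by (simp add: cga_abz_eq)
  also have "\<dots> = (\<Sum>C | C \<in> carrier (abz G T Mod N) \<and> C \<subseteq> C'. \<alpha> (ab_vimage N) (ab_vimage C))"
  proof (rule sum.reindex_bij_betw[symmetric])
    show "bij_betw ab_vimage {C. C \<in> carrier (abz G T Mod N) \<and> C \<subseteq> C'}
        {B. B \<in> carrier (G Mod ab_vimage N) \<and> B \<subseteq> ab_vimage C'}"
      unfolding bij_betw_def
    proof
      show "inj_on ab_vimage {C. C \<in> carrier (abz G T Mod N) \<and> C \<subseteq> C'}"
        using n(3) by (auto simp: bij_betw_def intro: inj_on_subset)
      have img: "ab_vimage ` carrier (abz G T Mod N) = carrier (G Mod ab_vimage N)"
        using n(3) by (simp add: bij_betw_def)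
      have sub_iff: "ab_vimage C \<subseteq> ab_vimage C' \<longleftrightarrow> C \<subseteq> C'" if "C \<in> carrier (abz G T Mod N)" for C
        using hom_vimage_subset_iff[OF abz_map_surj cos[OF that]] .
      show "ab_vimage ` {C. C \<in> carrier (abz G T Mod N) \<and> C \<subseteq> C'} =
          {B. B \<in> carrier (G Mod ab_vimage N) \<and> B \<subseteq> ab_vimage C'}"
      proof (intro equalityI subsetI)
        fix B assume "B \<in> {B. B \<in> carrier (G Mod ab_vimage N) \<and> B \<subseteq> ab_vimage C'}"
        moreover from this obtain C where "C \<in> carrier (abz G T Mod N)" "B = ab_vimage C"
          unfolding img[symmetric] by blast
        ultimately show "B \<in> ab_vimage ` {C. C \<in> carrier (abz G T Mod N) \<and> C \<subseteq> C'}"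
          using sub_iff by blast
      next
        fix B assume "B \<in> ab_vimage ` {C. C \<in> carrier (abz G T Mod N) \<and> C \<subseteq> C'}"
        then obtain C where C: "C \<in> carrier (abz G T Mod N)" "C \<subseteq> C'" "B = ab_vimage C" by blast
        have "B \<in> carrier (G Mod ab_vimage N)" using C img by blast
        then show "B \<in> {B. B \<in> carrier (G Mod ab_vimage N) \<and> B \<subseteq> ab_vimage C'}"
          using C sub_iff by blast
      qed
    qed
  qed
  also have "\<dots> = (\<Sum>C | C \<in> carrier (abz G T Mod N) \<and> C \<subseteq> C'. cga_abz G T \<alpha> N C)"
    using N by (simp add: cga_abz_eq)
  finally show "cga_abz G T \<alpha> N' C' = \<dots>" .
qed (auto simp: cga_abz_eq)

text \<open>The sum over one finite quotient becomes the sum over the other by the isomorphism above, which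
  respects the products and inverses occurring in the convolution.\<close>

lemma cga_abz_mult:
  fixes \<alpha> \<beta> :: "'g set \<Rightarrow> 'g set \<Rightarrow> 'c::prime_card zl"
  shows "cga_abz G T (\<alpha> \<otimes>\<^bsub>cga G T\<^esub> \<beta>) =
    cga_abz G T \<alpha> \<otimes>\<^bsub>cga (abz G T) (abz_top G T)\<^esub> cga_abz G T \<beta>"
proof (intro ext)
  fix N C
  show "cga_abz G T (\<alpha> \<otimes>\<^bsub>cga G T\<^esub> \<beta>) N C =
    (cga_abz G T \<alpha> \<otimes>\<^bsub>cga (abz G T) (abz_top G T)\<^esub> cga_abz G T \<beta>) N C"
  proof (cases "N \<in> open_normal (abz G T) (abz_top G T) \<and> C \<in> carrier (abz G T Mod N)")
    case True
    then have N: "N \<in> open_normal (abz G T) (abz_top G T)" and C: "C \<in> carrier (abz G T Mod N)" by auto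
    note n = ab_vimage_Mod[OF N]
    interpret v: group_hom "abz G T Mod N" "G Mod ab_vimage N" ab_vimage by (rule n(2))
    have "cga_abz G T (\<alpha> \<otimes>\<^bsub>cga G T\<^esub> \<beta>) N C =
      (\<Sum>B\<in>carrier (G Mod ab_vimage N). \<alpha> (ab_vimage N) B *
         \<beta> (ab_vimage N) (inv\<^bsub>G Mod ab_vimage N\<^esub> B \<otimes>\<^bsub>G Mod ab_vimage N\<^esub> ab_vimage C))"
      using N C n(1) v.hom_closed[OF C] by (simp del: mult_FactGroup add: cga_abz_eq cga_mult)
    also have "\<dots> = (\<Sum>A\<in>carrier (abz G T Mod N). \<alpha> (ab_vimage N) (ab_vimage A) *
         \<beta> (ab_vimage N) (inv\<^bsub>G Mod ab_vimage N\<^esub> ab_vimage A \<otimes>\<^bsub>G Mod ab_vimage N\<^esub> ab_vimage C))"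
      by (rule sum.reindex_bij_betw[OF n(3), symmetric])
    also have "\<dots> = (\<Sum>A\<in>carrier (abz G T Mod N). cga_abz G T \<alpha> N A *
         cga_abz G T \<beta> N (inv\<^bsub>abz G T Mod N\<^esub> A \<otimes>\<^bsub>abz G T Mod N\<^esub> C))"
    proof (rule sum.cong[OF refl])
      fix A assume A: "A \<in> carrier (abz G T Mod N)"
      have "inv\<^bsub>G Mod ab_vimage N\<^esub> ab_vimage A \<otimes>\<^bsub>G Mod ab_vimage N\<^esub> ab_vimage C =
          ab_vimage (inv\<^bsub>abz G T Mod N\<^esub> A \<otimes>\<^bsub>abz G T Mod N\<^esub> C)"
        using A C by (simp del: mult_FactGroup)
      moreover have "inv\<^bsub>abz G T Mod N\<^esub> A \<otimes>\<^bsub>abz G T Mod N\<^esub> C \<in> carrier (abz G T Mod N)"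
        using A C by (simp del: mult_FactGroup)
      ultimately show "\<alpha> (ab_vimage N) (ab_vimage A) *
         \<beta> (ab_vimage N) (inv\<^bsub>G Mod ab_vimage N\<^esub> ab_vimage A \<otimes>\<^bsub>G Mod ab_vimage N\<^esub> ab_vimage C) =
         cga_abz G T \<alpha> N A * cga_abz G T \<beta> N (inv\<^bsub>abz G T Mod N\<^esub> A \<otimes>\<^bsub>abz G T Mod N\<^esub> C)"
        using A N by (simp del: mult_FactGroup add: cga_abz_eq)
    qed
    also have "\<dots> = (cga_abz G T \<alpha> \<otimes>\<^bsub>cga (abz G T) (abz_top G T)\<^esub> cga_abz G T \<beta>) N C"
      using N C by (simp del: mult_FactGroup add: cga_mult)
    finally show ?thesis .
  qed (auto simp: cga_abz_eq cga_mult)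
qed

lemma cga_abz_cga_of:
  assumes a: "a \<in> carrier G"
  shows "cga_abz G T (cga_of G T a) =
    (cga_of (abz G T) (abz_top G T) (abz_map G T a) :: 'g set set \<Rightarrow> 'g set set \<Rightarrow> 'c::prime_card zl)"
proof (intro ext)
  fix N C
  interpret h: group_hom G "abz G T" "abz_map G T" by (rule abz_map_hom)
  have Na: "N #>\<^bsub>abz G T\<^esub> abz_map G T a \<in> carrier (abz G T Mod N)"
    using a by (auto simp: carrier_Mod_iff)
  show "cga_abz G T (cga_of G T a) N C =
      (cga_of (abz G T) (abz_top G T) (abz_map G T a) N C :: 'c zl)"
  proof (cases "N \<in> open_normal (abz G T) (abz_top G T) \<and> C \<in> carrier (abz G T Mod N)")
    case True
    then have N: "N \<in> open_normal (abz G T) (abz_top G T)" and C: "C \<in> carrier (abz G T Mod N)" by auto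
    note n = ab_vimage_Mod[OF N]
    have "subgroup N (abz G T)" using N by (auto simp: open_normal_def normal_imp_subgroup)
    then have "ab_vimage C = ab_vimage N #> a \<longleftrightarrow> ab_vimage C = ab_vimage (N #>\<^bsub>abz G T\<^esub> abz_map G T a)"
      using h.hom_vimage_rcoset a by simp
    also have "\<dots> \<longleftrightarrow> C = N #>\<^bsub>abz G T\<^esub> abz_map G T a"
      using n(3) C Na by (auto simp: bij_betw_def inj_on_eq_iff)
    finally show ?thesis using N C n(1) by (simp add: cga_abz_eq cga_of_def)
  qed (use Na in \<open>auto simp: cga_abz_eq cga_of_def\<close>)
qed

lemma cga_abz_one:
  "cga_abz G T \<one>\<^bsub>cga G T\<^esub> =
    (\<one>\<^bsub>cga (abz G T) (abz_top G T)\<^esub> :: 'g set set \<Rightarrow> 'g set set \<Rightarrow> 'c::prime_card zl)"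
proof (intro ext)
  fix N C
  interpret h: group_hom G "abz G T" "abz_map G T" by (rule abz_map_hom)
  have "cga_abz G T \<one>\<^bsub>cga G T\<^esub> N C = (cga_of (abz G T) (abz_top G T) \<one>\<^bsub>abz G T\<^esub> N C :: 'c zl)"
    by (metis cga_abz_cga_of cga_of_one h.hom_one one_closed)
  moreover have "N #>\<^bsub>abz G T\<^esub> \<one>\<^bsub>abz G T\<^esub> = N" if "N \<in> open_normal (abz G T) (abz_top G T)"
    using that h.H.coset_mult_one by (auto simp: open_normal_def dest!: normal_imp_subgroup subgroup.subset)
  ultimately show "cga_abz G T \<one>\<^bsub>cga G T\<^esub> N C = (\<one>\<^bsub>cga (abz G T) (abz_top G T)\<^esub> N C :: 'c zl)"
    by (auto simp: cga_of_def cga_def)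
qed

end

section \<open>Coefficients and convergence of commutative power series\<close>

lemma mps_eqI: "(\<And>m. mps_nth f m = mps_nth g m) \<Longrightarrow> f = g"
  by (simp add: mps_nth_inject[symmetric] fun_eq_iff)

lemmas mps_nth_arith = zero_mps.rep_eq one_mps.rep_eq plus_mps.rep_eq minus_mps.rep_eq
  uminus_mps.rep_eq

lemma mps_nth_sum: "mps_nth (\<Sum>j\<in>J. f j) m = (\<Sum>j\<in>J. mps_nth (f j) m)"
  by (induction J rule: infinite_finite_induct) (simp_all add: mps_nth_arith)

lemma mps_nth_const: "mps_nth (mps_const c) m = (if m = {#} then c else 0)"
  by (simp add: mps_const_def Abs_mps_inverse)

lemma mps_const_0 [simp]: "mps_const 0 = (0 :: 'a::comm_ring_1 mps)"
  and mps_const_1 [simp]: "mps_const 1 = (1 :: 'a::comm_ring_1 mps)"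
  by (auto intro!: mps_eqI simp: mps_nth_const mps_nth_arith)

lemma mps_nth_const_mult:
  fixes f :: "'a::comm_ring_1 mps"
  shows "mps_nth (mps_const c * f) m = c * mps_nth f m"
proof -
  have "mps_nth (mps_const c * f) m =
      (\<Sum>p\<in>{(a, b). a + b = m}. mps_nth (mps_const c) (fst p) * mps_nth f (snd p))"
    by (simp add: times_mps.rep_eq case_prod_unfold)
  also have "\<dots> = (\<Sum>p\<in>{({#}, m)}. mps_nth (mps_const c) (fst p) * mps_nth f (snd p))"
    by (rule sum.mono_neutral_right) (auto simp: mps_nth_const finite_mset_splits)
  finally show ?thesis by (simp add: mps_nth_const)
qed

lemma mps_nth_mult_var:
  fixes f :: "'a::comm_ring_1 mps"
  shows "mps_nth (f * mps_var i) m = (if i \<in># m then mps_nth f (m - {#i#}) else 0)"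
proof -
  let ?t = "\<lambda>p. mps_nth f (fst p) * (if snd p = {#i#} then 1 else 0)"
  have "mps_nth (f * mps_var i) m = (\<Sum>p\<in>{(a, b). a + b = m}. ?t p)"
    by (simp add: times_mps.rep_eq case_prod_unfold mps_var_def Abs_mps_inverse)
  also have "\<dots> = (\<Sum>p\<in>(if i \<in># m then {(m - {#i#}, {#i#})} else {}). ?t p)"
    by (rule sum.mono_neutral_right) (auto simp: finite_mset_splits split: if_splits)
  finally show ?thesis by simp
qed

text \<open>A variable is not a zero divisor, so the description of the exact quotient has at most one solution.\<close>

lemma mps_quot_var:
  assumes "f = q * mps_var i"
  shows "mps_quot f (mps_var i) = q"
  unfolding mps_quot_def
proof (rule the_equality)
  show "q * mps_var i = f" using assms by simp
  fix q' assume "q' * mps_var i = f"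
  then have "mps_nth (q' * mps_var i) (add_mset i m) = mps_nth (q * mps_var i) (add_mset i m)" for m
    using assms by simp
  then show "q' = q" by (intro mps_eqI) (simp add: mps_nth_mult_var)
qed

lemma mps_nth_mono_u: "mps_nth (mono_u w :: 'a::comm_ring_1 mps) m = (if m = mset w then 1 else 0)"
proof (induction w arbitrary: m)
  case Nil show ?case by (simp add: mono_u_def mps_nth_arith)
next
  case (Cons i w)
  have "mono_u (i # w) = (mono_u w * mps_var i :: 'a mps)" by (simp add: mono_u_def mult.commute)
  then show ?case by (auto simp: mps_nth_mult_var Cons dest: insert_DiffM)
qed

lemma finite_mset_eq: "finite {w. mset w = m \<and> P w}"
proof -
  obtain v where v: "m = mset v" by (metis ex_mset)
  show ?thesis by (rule finite_subset[OF _ finite_lists_length_le[of "set_mset m" "size m"]]) auto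
qed

text \<open>The counterpart on words of the recursion by which Fox derivatives remove the last letter of a
  monomial.\<close>

lemma sum_mset_eq_split_last:
  fixes f :: "nat list \<Rightarrow> 'a::comm_monoid_add"
  assumes "m \<noteq> {#}" and "set_mset m \<subseteq> A" and "finite A"
  shows "(\<Sum>w | mset w = m. f w) = (\<Sum>k\<in>A. if k \<in># m then \<Sum>v | mset v = m - {#k#}. f (v @ [k]) else 0)"
proof -
  have "(\<Sum>w | mset w = m. f w) = (\<Sum>k\<in>A. \<Sum>w\<in>{w. w \<in> {w. mset w = m} \<and> last w = k}. f w)"
  proof (rule sum.group[symmetric])
    show "last ` {w. mset w = m} \<subseteq> A"
      using assms(1,2) by (auto simp del: set_mset_mset simp: set_mset_mset[symmetric])
         (metis last_in_set mset_zero_iff set_mset_mset subsetD)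
  qed (use finite_mset_eq[of m "\<lambda>_. True"] assms(3) in auto)
  also have "\<dots> = (\<Sum>k\<in>A. if k \<in># m then \<Sum>v | mset v = m - {#k#}. f (v @ [k]) else 0)"
  proof (rule sum.cong[OF refl])
    fix k
    show "(\<Sum>w\<in>{w. w \<in> {w. mset w = m} \<and> last w = k}. f w) =
        (if k \<in># m then \<Sum>v | mset v = m - {#k#}. f (v @ [k]) else 0)"
    proof (cases "k \<in># m")
      case True
      have "(\<Sum>w\<in>{w. w \<in> {w. mset w = m} \<and> last w = k}. f w) =
          (\<Sum>v | mset v = m - {#k#}. f (v @ [k]))"
      proof (rule sum.reindex_bij_witness[where i = "\<lambda>v. v @ [k]" and j = butlast])
        fix w assume w: "w \<in> {w. w \<in> {w. mset w = m} \<and> last w = k}"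
        then have "w \<noteq> []" using assms(1) by auto
        then have ww: "butlast w @ [k] = w" using w append_butlast_last_id by blast
        then show "butlast w @ [k] = w" and "f (butlast w @ [k]) = f w" by simp_all
        have "mset (butlast w @ [k]) = m" using w ww by simp
        then show "butlast w \<in> {v. mset v = m - {#k#}}" by auto
      qed (use True in auto)
      then show ?thesis using True by simp
    next
      case False
      then have "{w. w \<in> {w. mset w = m} \<and> last w = k} = {}"
        using assms(1) last_in_set by auto
      then show ?thesis using False by (simp only: sum.empty if_False)
    qed
  qed
  finally show ?thesis .
qed

lemma tendsto_fun_pointwise:
  fixes f :: "'n \<Rightarrow> 'a \<Rightarrow> 'b::topological_space"
  assumes "\<And>z. ((\<lambda>n. f n z) \<longlongrightarrow> g z) F"
  shows "(f \<longlongrightarrow> g) F"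
proof -
  have "limitin (product_topology (\<lambda>_. euclidean) UNIV) f g F"
    unfolding limitin_componentwise using assms by simp
  then show ?thesis by (simp add: euclidean_product_topology)
qed

text \<open>The topology on power series is defined by taking images under the coefficient map, so convergence
  is tested on coefficients.\<close>

lemma tendsto_mps:
  fixes f :: "'n \<Rightarrow> 'a::t2_space mps"
  assumes "\<And>m. ((\<lambda>n. mps_nth (f n) m) \<longlongrightarrow> mps_nth g m) F"
  shows "(f \<longlongrightarrow> g) F"
proof (rule topological_tendstoI)
  fix U :: "'a mps set" assume U: "open U" "g \<in> U"
  have "((\<lambda>n. mps_nth (f n)) \<longlongrightarrow> mps_nth g) F"
    by (rule tendsto_fun_pointwise) (rule assms)
  moreover have "open (mps_nth ` U)" using U by (simp add: open_mps_def)
  ultimately have "eventually (\<lambda>n. mps_nth (f n) \<in> mps_nth ` U) F"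
    using U by (auto dest: topological_tendstoD)
  then show "eventually (\<lambda>n. f n \<in> U) F"
    by (rule eventually_mono) (auto simp: mps_nth_inject)
qed

lemma finite_words: "finite (words r n)"
  using finite_lists_length_eq[of "{1..r}" n] by (simp add: words_def conj_commute)

text \<open>Only the words of one length contribute to a given monomial, so every
  coefficient of the partial sums is eventually constant.\<close>

lemma word_series_sums:
  fixes f :: "nat list \<Rightarrow> 'l::prime_card zl"
  shows "(\<lambda>n. \<Sum>w\<in>words r (Suc n). mps_const (f w) * mono_u w) sums
    Abs_mps (\<lambda>m. if m = {#} then 0 else \<Sum>w | mset w = m \<and> set w \<subseteq> {1..r}. f w)"
    (is "_ sums Abs_mps ?g")
  unfolding sums_def
proof (rule tendsto_mps)
  fix m
  have summand: "mps_nth (\<Sum>w\<in>words r (Suc n). mps_const (f w) * mono_u w) m =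
      (if n = size m - 1 then ?g m else 0)" for n
  proof -
    have "mps_nth (\<Sum>w\<in>words r (Suc n). mps_const (f w) * mono_u w) m =
        (\<Sum>w\<in>words r (Suc n). if m = mset w then f w else 0)"
      by (simp add: mps_nth_sum mps_nth_const_mult mps_nth_mono_u if_distrib cong: if_cong)
    also have "\<dots> = (\<Sum>w\<in>{w \<in> words r (Suc n). m = mset w}. f w)"
      by (simp add: sum.inter_filter finite_words)
    also have "\<dots> = (if n = size m - 1 then ?g m else 0)"
    proof (cases "size m = Suc n")
      case True
      then have "{w \<in> words r (Suc n). m = mset w} = {w. mset w = m \<and> set w \<subseteq> {1..r}}"
        by (auto simp: words_def)
      then show ?thesis using True by auto
    next
      case False
      then have empty: "{w \<in> words r (Suc n). m = mset w} = {}" by (auto simp: words_def)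
      show ?thesis
        unfolding empty using False by (cases "m = {#}") (auto simp: nonempty_has_size)
    qed
    finally show ?thesis .
  qed
  have "\<forall>\<^sub>F N in sequentially.
      mps_nth (\<Sum>n<N. \<Sum>w\<in>words r (Suc n). mps_const (f w) * mono_u w) m = ?g m"
    using eventually_gt_at_top[of "size m"]
    by eventually_elim (simp add: mps_nth_sum[of _ "{..<_}"] summand)
  then show "(\<lambda>N. mps_nth (\<Sum>n<N. \<Sum>w\<in>words r (Suc n). mps_const (f w) * mono_u w) m)
      \<longlonglongrightarrow> mps_nth (Abs_mps ?g) m"
    by (simp add: Abs_mps_inverse tendsto_eventually)
qed

section \<open>Fox calculus on the complete group algebra\<close>

lemma top_alg_isoD:
  assumes "top_alg_iso A B f"
  shows "\<And>\<alpha>. \<alpha> \<in> carrier A \<Longrightarrow> f \<alpha> \<in> carrier B"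
    and "\<And>\<alpha> \<beta>. \<alpha> \<in> carrier A \<Longrightarrow> \<beta> \<in> carrier A \<Longrightarrow> f (\<alpha> \<otimes>\<^bsub>A\<^esub> \<beta>) = f \<alpha> \<otimes>\<^bsub>B\<^esub> f \<beta>"
    and "\<And>\<alpha> \<beta>. \<alpha> \<in> carrier A \<Longrightarrow> \<beta> \<in> carrier A \<Longrightarrow> f (\<alpha> \<oplus>\<^bsub>A\<^esub> \<beta>) = f \<alpha> \<oplus>\<^bsub>B\<^esub> f \<beta>"
    and "f \<one>\<^bsub>A\<^esub> = \<one>\<^bsub>B\<^esub>"
    and "\<And>c \<alpha>. \<alpha> \<in> carrier A \<Longrightarrow> f (c \<odot>\<^bsub>A\<^esub> \<alpha>) = c \<odot>\<^bsub>B\<^esub> f \<alpha>"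
    and "inj_on f (carrier A)"
    and "continuous_on (carrier A) f"
  using assms homeomorphic_imp_continuous_map[of "top_of_set (carrier A)" "top_of_set (carrier B)" f]
  by (auto simp: top_alg_iso_def ring_iso_def Ring.ring_hom_def bij_betw_def)

text \<open>The data of the theorem that concern the free group alone. The freeness of \<open>F\<close> enters through the
  Magnus isomorphism \<open>\<Theta>\<close>, which determines elements of the complete group algebra by their
  coefficients on words.\<close>

locale fox_calculus = pro_l_top_group F T l
  for F :: "('g, 'b) monoid_scheme" (structure) and T :: "'g topology" and l :: nat +
  fixes r :: nat and x :: "nat \<Rightarrow> 'g"
    and \<Theta> :: "('g set \<Rightarrow> 'g set \<Rightarrow> 'l::prime_card zl) \<Rightarrow> nat list \<Rightarrow> 'l zl"
    and \<theta> :: "('g set set \<Rightarrow> 'g set set \<Rightarrow> 'l zl) \<Rightarrow> 'l zl mps"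
    and D :: "nat \<Rightarrow> ('g set \<Rightarrow> 'g set \<Rightarrow> 'l zl) \<Rightarrow> ('g set \<Rightarrow> 'g set \<Rightarrow> 'l zl)"
  assumes l_card: "l = CARD('l)"
    and x_closed: "i \<in> {1..r} \<Longrightarrow> x i \<in> carrier F"
    and Theta: "is_Theta F T r x \<Theta>"
    and theta: "is_theta F T r x \<theta>"
    and fox: "is_fox F T r x D"
begin

abbreviation A :: "('l zl, 'g set \<Rightarrow> 'g set \<Rightarrow> 'l zl) module" where "A \<equiv> cga F T"

definition ab :: "('g set \<Rightarrow> 'g set \<Rightarrow> 'l zl) \<Rightarrow> 'l zl mps" where
  "ab \<alpha> = \<theta> (cga_abz F T \<alpha>)"

abbreviation elt :: "'g \<Rightarrow> ('g set \<Rightarrow> 'g set \<Rightarrow> 'l zl)" where "elt \<equiv> cga_of F T"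

interpretation A: abelian_group A by (rule cga_abelian_group)

lemmas theta_iso = top_alg_isoD[OF theta[unfolded is_theta_def, THEN conjunct1]]
lemmas Theta_iso = top_alg_isoD[OF Theta[unfolded is_Theta_def, THEN conjunct1]]

lemma cga_one_closed: "\<one>\<^bsub>A\<^esub> \<in> carrier A"
  using cga_of_closed[OF one_closed] by (simp add: cga_of_one)

lemma ab_add: "\<alpha> \<in> carrier A \<Longrightarrow> \<beta> \<in> carrier A \<Longrightarrow> ab (\<alpha> \<oplus>\<^bsub>A\<^esub> \<beta>) = ab \<alpha> + ab \<beta>"
  by (simp add: ab_def cga_abz_add cga_abz_closed theta_iso) (simp add: Lam_def)

lemma ab_mult: "\<alpha> \<in> carrier A \<Longrightarrow> \<beta> \<in> carrier A \<Longrightarrow> ab (\<alpha> \<otimes>\<^bsub>A\<^esub> \<beta>) = ab \<alpha> * ab \<beta>"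
  by (simp add: ab_def cga_abz_mult cga_abz_closed theta_iso) (simp add: Lam_def)

lemma ab_smult: "\<alpha> \<in> carrier A \<Longrightarrow> ab (c \<odot>\<^bsub>A\<^esub> \<alpha>) = mps_const c * ab \<alpha>"
  by (simp add: ab_def cga_abz_smult cga_abz_closed theta_iso) (simp add: Lam_def)

lemma ab_one: "ab \<one>\<^bsub>A\<^esub> = 1"
  by (simp add: ab_def cga_abz_one theta_iso) (simp add: Lam_def)

lemma ab_outside: "\<alpha> \<in> carrier A \<Longrightarrow> \<not> set_mset m \<subseteq> {1..r} \<Longrightarrow> mps_nth (ab \<alpha>) m = 0"
  using theta_iso(1)[OF cga_abz_closed, of \<alpha>] by (simp add: ab_def Lam_def)

lemma ab_elt_x: "j \<in> {1..r} \<Longrightarrow> ab (elt (x j)) = 1 + mps_var j"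
  using theta x_closed by (simp add: ab_def cga_abz_cga_of is_theta_def)

lemma continuous_on_ab: "continuous_on (carrier A) ab"
proof -
  have "continuous_on (carrier A) (\<lambda>\<alpha>. cga_abz F T \<alpha> N C)" for N C
  proof -
    have "continuous_on (carrier A) (\<lambda>\<alpha>. \<alpha> N' C')" for N' C'
      by (intro continuous_on_product_then_coordinatewise[of _ "\<lambda>\<alpha>. \<alpha> N'"]
          continuous_on_product_then_coordinatewise[of _ "\<lambda>\<alpha>. \<alpha>"] continuous_on_id)
    then show ?thesis
      unfolding cga_abz_eq
      by (cases "N \<in> open_normal (abz F T) (abz_top F T) \<and> C \<in> carrier (abz F T Mod N)")
         (simp_all only: if_True if_False simp_thms continuous_on_const)
  qed
  then have "continuous_on (carrier A) (cga_abz F T)"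
    by (intro continuous_on_coordinatewise_then_product)
  then have "continuous_on (carrier A) (\<lambda>\<alpha>. \<theta> (cga_abz F T \<alpha>))"
    using cga_abz_closed by (intro continuous_on_compose2[OF theta_iso(7)]) auto
  then show ?thesis by (simp add: ab_def[abs_def])
qed

lemma Theta_add: "\<alpha> \<in> carrier A \<Longrightarrow> \<beta> \<in> carrier A \<Longrightarrow> \<Theta> (\<alpha> \<oplus>\<^bsub>A\<^esub> \<beta>) w = \<Theta> \<alpha> w + \<Theta> \<beta> w"
  by (simp add: Theta_iso) (simp add: ncps_def)

lemma Theta_smult: "\<alpha> \<in> carrier A \<Longrightarrow> \<Theta> (c \<odot>\<^bsub>A\<^esub> \<alpha>) w = c * \<Theta> \<alpha> w"
  by (simp add: Theta_iso) (simp add: ncps_def)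

lemma Theta_mult:
  "\<alpha> \<in> carrier A \<Longrightarrow> \<beta> \<in> carrier A \<Longrightarrow>
    \<Theta> (\<alpha> \<otimes>\<^bsub>A\<^esub> \<beta>) w = (\<Sum>i\<le>length w. \<Theta> \<alpha> (take i w) * \<Theta> \<beta> (drop i w))"
  by (simp add: Theta_iso) (simp add: ncps_def)

lemma Theta_one: "\<Theta> \<one>\<^bsub>A\<^esub> w = (if w = [] then 1 else 0)"
  by (simp add: Theta_iso) (simp add: ncps_def)

lemma Theta_outside: "\<alpha> \<in> carrier A \<Longrightarrow> \<not> set w \<subseteq> {1..r} \<Longrightarrow> \<Theta> \<alpha> w = 0"
  using Theta_iso(1)[of \<alpha>] by (simp add: ncps_def)

lemma Theta_eqI: "\<alpha> \<in> carrier A \<Longrightarrow> \<beta> \<in> carrier A \<Longrightarrow> (\<And>w. \<Theta> \<alpha> w = \<Theta> \<beta> w) \<Longrightarrow> \<alpha> = \<beta>"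
  using Theta_iso(6) by (metis ext inj_onD)

lemma Theta_elt_x:
  "j \<in> {1..r} \<Longrightarrow> \<Theta> (elt (x j)) w = (if w = [] then 1 else 0) + (if w = [j] then 1 else 0)"
  using Theta by (simp add: is_Theta_def) (simp add: ncps_def ncps_var_def)

lemma D_closed: "j \<in> {1..r} \<Longrightarrow> \<alpha> \<in> carrier A \<Longrightarrow> D j \<alpha> \<in> carrier A"
  using fox by (auto simp: is_fox_def Let_def)

lemma continuous_on_D: "j \<in> {1..r} \<Longrightarrow> continuous_on (carrier A) (D j)"
  using fox by (auto simp: is_fox_def Let_def)

text \<open>The defining equation of the Fox derivatives, in the form needed to compare coefficients under \<open>\<Theta>\<close>
  and under \<open>ab\<close> by the same argument.\<close>

lemma additive_fox_expansion:
  fixes h :: "_ \<Rightarrow> 'c::ab_group_add"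
  assumes h: "\<And>\<alpha> \<beta>. \<alpha> \<in> carrier A \<Longrightarrow> \<beta> \<in> carrier A \<Longrightarrow> h (\<alpha> \<oplus>\<^bsub>A\<^esub> \<beta>) = h \<alpha> + h \<beta>"
    and \<alpha>: "\<alpha> \<in> carrier A"
  shows "h \<alpha> = h (augmentation F \<alpha> \<odot>\<^bsub>A\<^esub> \<one>\<^bsub>A\<^esub>) +
    (\<Sum>j\<in>{1..r}. h (D j \<alpha> \<otimes>\<^bsub>A\<^esub> (elt (x j) \<ominus>\<^bsub>A\<^esub> \<one>\<^bsub>A\<^esub>)))"
proof -
  let ?f = "\<lambda>j. D j \<alpha> \<otimes>\<^bsub>A\<^esub> (elt (x j) \<ominus>\<^bsub>A\<^esub> \<one>\<^bsub>A\<^esub>)"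
  have f: "?f \<in> {1..r} \<rightarrow> carrier A"
    using \<alpha> by (auto intro!: cga_mult_closed D_closed A.minus_closed cga_of_closed x_closed cga_one_closed)
  have "\<alpha> = augmentation F \<alpha> \<odot>\<^bsub>A\<^esub> \<one>\<^bsub>A\<^esub> \<oplus>\<^bsub>A\<^esub> (\<Oplus>\<^bsub>A\<^esub>j\<in>{1..r}. ?f j)"
    using fox \<alpha> unfolding is_fox_def Let_def by blast
  then have "h \<alpha> = h (augmentation F \<alpha> \<odot>\<^bsub>A\<^esub> \<one>\<^bsub>A\<^esub> \<oplus>\<^bsub>A\<^esub> (\<Oplus>\<^bsub>A\<^esub>j\<in>{1..r}. ?f j))"
    by (rule arg_cong)
  also have "\<dots> = h (augmentation F \<alpha> \<odot>\<^bsub>A\<^esub> \<one>\<^bsub>A\<^esub>) + (\<Sum>j\<in>{1..r}. h (?f j))"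
    using f by (simp add: h cga_smult_closed cga_one_closed A.additive_finsum[of h, OF h])
  finally show ?thesis .
qed

text \<open>The last summand belongs to the split with empty second factor; it becomes the term with the
  augmentation in the product rule.\<close>

lemma Theta_snoc:
  assumes "\<alpha> \<in> carrier A" and "\<beta> \<in> carrier A"
  shows "\<Theta> (\<alpha> \<otimes>\<^bsub>A\<^esub> \<beta>) (w @ [k]) =
    (\<Sum>i\<le>length w. \<Theta> \<alpha> (take i w) * \<Theta> \<beta> (drop i w @ [k])) + \<Theta> \<alpha> (w @ [k]) * \<Theta> \<beta> []"
  using assms by (simp add: Theta_mult)

lemma Theta_mult_x:
  assumes \<alpha>: "\<alpha> \<in> carrier A" and j: "j \<in> {1..r}"
  shows "\<Theta> (\<alpha> \<otimes>\<^bsub>A\<^esub> (elt (x j) \<ominus>\<^bsub>A\<^esub> \<one>\<^bsub>A\<^esub>)) [] = 0"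
    and "\<Theta> (\<alpha> \<otimes>\<^bsub>A\<^esub> (elt (x j) \<ominus>\<^bsub>A\<^esub> \<one>\<^bsub>A\<^esub>)) (w @ [k]) = (if k = j then \<Theta> \<alpha> w else 0)"
proof -
  have X: "elt (x j) \<ominus>\<^bsub>A\<^esub> \<one>\<^bsub>A\<^esub> \<in> carrier A"
    using j by (intro A.minus_closed cga_of_closed x_closed cga_one_closed)
  have T: "\<Theta> (elt (x j) \<ominus>\<^bsub>A\<^esub> \<one>\<^bsub>A\<^esub>) v = (if v = [j] then 1 else 0)" for v
    using A.additive_minus[of "\<lambda>\<alpha>. \<Theta> \<alpha> v", OF Theta_add cga_of_closed[OF x_closed[OF j]] cga_one_closed]
    by (simp add: Theta_elt_x[OF j] Theta_one)
  show "\<Theta> (\<alpha> \<otimes>\<^bsub>A\<^esub> (elt (x j) \<ominus>\<^bsub>A\<^esub> \<one>\<^bsub>A\<^esub>)) [] = 0" using \<alpha> X by (simp add: Theta_mult T)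
  have "(\<Sum>i\<le>length w. \<Theta> \<alpha> (take i w) * (if drop i w @ [k] = [j] then 1 else 0)) =
      (\<Sum>i\<le>length w. if i = length w then (if k = j then \<Theta> \<alpha> w else 0) else 0)"
    by (intro sum.cong) auto
  then show "\<Theta> (\<alpha> \<otimes>\<^bsub>A\<^esub> (elt (x j) \<ominus>\<^bsub>A\<^esub> \<one>\<^bsub>A\<^esub>)) (w @ [k]) = (if k = j then \<Theta> \<alpha> w else 0)"
    using \<alpha> X by (simp add: Theta_snoc T)
qed

lemma Theta_Nil: "\<alpha> \<in> carrier A \<Longrightarrow> \<Theta> \<alpha> [] = augmentation F \<alpha>"
  using additive_fox_expansion[of "\<lambda>\<alpha>. \<Theta> \<alpha> []", OF Theta_add]
  by (simp add: Theta_mult_x D_closed Theta_smult cga_one_closed Theta_one)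

text \<open>Multiplying by \<open>x\<^sub>j - 1\<close> appends the letter \<open>j\<close> to every word, so only the summand \<open>j = k\<close> of the
  expansion contributes to words ending in \<open>k\<close>.\<close>

lemma Theta_D: "\<alpha> \<in> carrier A \<Longrightarrow> k \<in> {1..r} \<Longrightarrow> \<Theta> (D k \<alpha>) w = \<Theta> \<alpha> (w @ [k])"
  using additive_fox_expansion[of "\<lambda>\<alpha>. \<Theta> \<alpha> (w @ [k])", OF Theta_add]
  by (simp add: Theta_mult_x D_closed Theta_smult cga_one_closed Theta_one)

lemma ab_fox:
  assumes \<alpha>: "\<alpha> \<in> carrier A"
  shows "ab \<alpha> = mps_const (augmentation F \<alpha>) + (\<Sum>j\<in>{1..r}. ab (D j \<alpha>) * mps_var j)"
proof -
  have "ab (D j \<alpha> \<otimes>\<^bsub>A\<^esub> (elt (x j) \<ominus>\<^bsub>A\<^esub> \<one>\<^bsub>A\<^esub>)) = ab (D j \<alpha>) * mps_var j" if j: "j \<in> {1..r}" for j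
  proof -
    have X: "elt (x j) \<in> carrier A" using j by (intro cga_of_closed x_closed)
    have "ab (elt (x j) \<ominus>\<^bsub>A\<^esub> \<one>\<^bsub>A\<^esub>) = mps_var j"
      using A.additive_minus[of ab, OF ab_add X cga_one_closed] j by (simp add: ab_elt_x ab_one)
    then show ?thesis using j \<alpha> X by (simp add: ab_mult D_closed A.minus_closed cga_one_closed)
  qed
  then show ?thesis
    using additive_fox_expansion[of ab, OF ab_add \<alpha>] by (simp add: ab_smult cga_one_closed ab_one)
qed

text \<open>Passing to the abelianization makes the variables of the Magnus expansion commute. Both sides satisfy
  the same recursion: removing the last letter of a word corresponds to replacing \<open>\<alpha>\<close> by a Fox
  derivative, which lowers the degree of the monomial.\<close>

lemma mps_nth_ab:
  "\<alpha> \<in> carrier A \<Longrightarrow> mps_nth (ab \<alpha>) m = (\<Sum>w | mset w = m. \<Theta> \<alpha> w)"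
proof (induction "size m" arbitrary: m \<alpha> rule: less_induct)
  case less
  show ?case
  proof (cases "m = {#}")
    case True
    then show ?thesis
      using less(2) by (subst ab_fox) (simp_all add: mps_nth_arith mps_nth_const mps_nth_sum mps_nth_mult_var Theta_Nil)
  next
    case ne: False
    show ?thesis
    proof (cases "set_mset m \<subseteq> {1..r}")
      case True
      have "mps_nth (ab \<alpha>) m =
          (\<Sum>j\<in>{1..r}. if j \<in># m then mps_nth (ab (D j \<alpha>)) (m - {#j#}) else 0)"
        using ne less(2)
        by (subst ab_fox) (simp_all add: mps_nth_arith mps_nth_const mps_nth_sum mps_nth_mult_var)
      also have "\<dots> = (\<Sum>j\<in>{1..r}. if j \<in># m then \<Sum>v | mset v = m - {#j#}. \<Theta> \<alpha> (v @ [j]) else 0)"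
        using less by (intro sum.cong refl) (auto simp: D_closed Theta_D size_Diff1_less)
      also have "\<dots> = (\<Sum>w | mset w = m. \<Theta> \<alpha> w)"
        by (rule sum_mset_eq_split_last[OF ne True, symmetric]) simp
      finally show ?thesis .
    next
      case False
      have "(\<Sum>w | mset w = m. \<Theta> \<alpha> w) = 0"
      proof (rule sum.neutral, clarify)
        fix w assume "m = mset w"
        then have "\<not> set w \<subseteq> {1..r}" using False by simp
        then show "\<Theta> \<alpha> w = 0" by (rule Theta_outside[OF less(2)])
      qed
      then show ?thesis using ab_outside[OF less(2) False] by simp
    qed
  qed
qed

text \<open>The product rule holds because its two sides have the same Magnus expansion.\<close>

lemma D_mult:
  assumes \<alpha>: "\<alpha> \<in> carrier A" and \<beta>: "\<beta> \<in> carrier A" and k: "k \<in> {1..r}"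
  shows "D k (\<alpha> \<otimes>\<^bsub>A\<^esub> \<beta>) = augmentation F \<beta> \<odot>\<^bsub>A\<^esub> D k \<alpha> \<oplus>\<^bsub>A\<^esub> \<alpha> \<otimes>\<^bsub>A\<^esub> D k \<beta>"
proof (rule Theta_eqI)
  show "D k (\<alpha> \<otimes>\<^bsub>A\<^esub> \<beta>) \<in> carrier A"
    "augmentation F \<beta> \<odot>\<^bsub>A\<^esub> D k \<alpha> \<oplus>\<^bsub>A\<^esub> \<alpha> \<otimes>\<^bsub>A\<^esub> D k \<beta> \<in> carrier A"
    using assms by (auto intro!: D_closed cga_mult_closed A.a_closed cga_smult_closed)
  show "\<Theta> (D k (\<alpha> \<otimes>\<^bsub>A\<^esub> \<beta>)) w = \<Theta> (augmentation F \<beta> \<odot>\<^bsub>A\<^esub> D k \<alpha> \<oplus>\<^bsub>A\<^esub> \<alpha> \<otimes>\<^bsub>A\<^esub> D k \<beta>) w" for w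
    using assms
    by (simp add: Theta_D cga_mult_closed Theta_snoc Theta_add D_closed cga_smult_closed Theta_smult
        Theta_mult[of \<alpha> "D k \<beta>"] Theta_Nil algebra_simps)
qed

text \<open>The images in commuting power series of a group element and of its Fox derivatives. The
  entries of the Gassner matrix are the values of \<open>fox_ab i\<close> at the images of the generators.\<close>

definition ab_of :: "'g \<Rightarrow> 'l zl mps" where "ab_of g = ab (elt g)"

definition fox_ab :: "nat \<Rightarrow> 'g \<Rightarrow> 'l zl mps" where "fox_ab k g = ab (D k (elt g))"

lemma ab_of_mult: "g \<in> carrier F \<Longrightarrow> h \<in> carrier F \<Longrightarrow> ab_of (g \<otimes> h) = ab_of g * ab_of h"
  by (simp add: ab_of_def cga_of_mult[symmetric] ab_mult cga_of_closed)

lemma ab_of_one: "ab_of \<one> = 1"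
  by (simp add: ab_of_def cga_of_one ab_one)

lemma ab_of_x: "j \<in> {1..r} \<Longrightarrow> ab_of (x j) = 1 + mps_var j"
  by (simp add: ab_of_def ab_elt_x)

lemma ab_of_pow: "g \<in> carrier F \<Longrightarrow> ab_of (g [^] (n::nat)) = ab_of g ^ n"
  by (induction n) (simp_all add: ab_of_one ab_of_mult mult.commute)

lemma fox_ab_mult:
  assumes "g \<in> carrier F" "h \<in> carrier F" "k \<in> {1..r}"
  shows "fox_ab k (g \<otimes> h) = fox_ab k g + ab_of g * fox_ab k h"
  using assms
  by (simp add: fox_ab_def ab_of_def cga_of_mult[symmetric] D_mult cga_of_closed augmentation_cga_of
      ab_add cga_smult_closed D_closed cga_mult_closed ab_smult ab_mult)

text \<open>The fundamental formula of Fox calculus after abelianization; group elements have augmentation 1.\<close>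

lemma fox_ab_fundamental:
  "g \<in> carrier F \<Longrightarrow> ab_of g = 1 + (\<Sum>j\<in>{1..r}. fox_ab j g * mps_var j)"
  using ab_fox[OF cga_of_closed, of g] by (simp add: ab_of_def fox_ab_def augmentation_cga_of)

lemma mps_nth_fox_ab:
  "g \<in> carrier F \<Longrightarrow> k \<in> {1..r} \<Longrightarrow>
    mps_nth (fox_ab k g) m = (\<Sum>w | mset w = m. magnus_coeff F T \<Theta> (w @ [k]) g)"
  by (simp add: fox_ab_def mps_nth_ab D_closed cga_of_closed Theta_D magnus_coeff_def)

lemma fox_ab_x:
  assumes "j \<in> {1..r}" "k \<in> {1..r}" "k \<noteq> j" shows "fox_ab k (x j) = 0"
  using assms x_closed
  by (intro mps_eqI) (simp add: fox_ab_def mps_nth_ab D_closed cga_of_closed Theta_D Theta_elt_x mps_nth_arith)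

lemma fox_ab_one: "k \<in> {1..r} \<Longrightarrow> fox_ab k \<one> = 0"
  using fox_ab_mult[of \<one> \<one> k] by (simp add: ab_of_one)

lemma fox_ab_x_pow:
  assumes "j \<in> {1..r}" "k \<in> {1..r}" "k \<noteq> j" shows "fox_ab k (x j [^] (n::nat)) = 0"
  using assms x_closed
  by (induction n) (simp_all add: fox_ab_one fox_ab_mult fox_ab_x)

text \<open>Each coefficient of the group element in the complete group algebra depends on a single coset, hence
  is eventually constant along a convergent sequence.\<close>

lemma tendsto_elt:
  fixes h :: "('g set \<Rightarrow> 'g set \<Rightarrow> 'l zl) \<Rightarrow> 'c::topological_space"
  assumes h: "continuous_on (carrier A) h" and lim: "limitin T s b sequentially"
    and s: "\<And>n. s n \<in> carrier F"
  shows "(\<lambda>n. h (elt (s n))) \<longlonglongrightarrow> h (elt b)"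
proof (rule continuous_on_tendsto_compose[OF h])
  have b: "b \<in> carrier F" using lim by (simp add: limitin_def)
  show "elt b \<in> carrier A" using b by (rule cga_of_closed)
  show "\<forall>\<^sub>F n in sequentially. elt (s n) \<in> carrier A" using s by (simp add: cga_of_closed)
  show "(\<lambda>n. elt (s n)) \<longlonglongrightarrow> elt b"
  proof (intro tendsto_fun_pointwise)
    fix N C
    show "(\<lambda>n. elt (s n) N C) \<longlonglongrightarrow> elt b N C"
    proof (cases "N \<in> open_normal F T")
      case True
      from limit_coset[OF lim this] obtain m where "\<forall>n\<ge>m. N #> s n = N #> b" ..
      then have "\<forall>n\<ge>m. elt (s n) N C = elt b N C" by (simp add: cga_of_def)
      then have "\<forall>\<^sub>F n in sequentially. elt (s n) N C = elt b N C"
        unfolding eventually_sequentially by blast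
      then show ?thesis by (rule tendsto_eventually)
    qed (simp add: cga_of_def)
  qed
qed

context
  fixes j and c :: "'l zl"
  assumes j: "j \<in> {1..r}"
begin

lemma limitin_x_pow: "limitin T (\<lambda>n. x j [^] zl_res c n) (pro_pow F T (x j) c) sequentially"
  using limitin_pro_pow[OF l_card x_closed[OF j]] .

lemma x_pow_closed: "pro_pow F T (x j) c \<in> carrier F"
  using limitin_x_pow by (simp add: limitin_def)

lemma ab_of_x_pro_pow: "ab_of (pro_pow F T (x j) c) = zl_power (1 + mps_var j) c"
proof -
  have "(\<lambda>n. ab_of (x j [^] zl_res c n)) \<longlonglongrightarrow> ab_of (pro_pow F T (x j) c)"
    unfolding ab_of_def using x_closed[OF j]
    by (intro tendsto_elt[OF continuous_on_ab limitin_x_pow]) simp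
  then have "(\<lambda>n. (1 + mps_var j) ^ zl_res c n) \<longlonglongrightarrow> ab_of (pro_pow F T (x j) c)"
    using j x_closed by (simp add: ab_of_pow ab_of_x)
  then show ?thesis unfolding zl_power_def by (rule limI[symmetric])
qed

text \<open>For ordinary powers this is the product rule; the limit is passed through the continuous map \<open>D k\<close>.\<close>

lemma fox_ab_x_pro_pow:
  assumes k: "k \<in> {1..r}" "k \<noteq> j"
  shows "fox_ab k (pro_pow F T (x j) c) = 0"
proof -
  have "continuous_on (carrier A) (\<lambda>\<alpha>. ab (D k \<alpha>))"
    using k by (intro continuous_on_compose2[OF continuous_on_ab continuous_on_D]) (auto intro: D_closed)
  then have "(\<lambda>n. ab (D k (elt (x j [^] zl_res c n)))) \<longlonglongrightarrow> ab (D k (elt (pro_pow F T (x j) c)))"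
    using x_closed[OF j] by (intro tendsto_elt[OF _ limitin_x_pow]) simp_all
  then have "(\<lambda>n. 0) \<longlonglongrightarrow> fox_ab k (pro_pow F T (x j) c)"
    using fox_ab_x_pow[OF j k] by (simp add: fox_ab_def)
  then show ?thesis by (simp only: LIMSEQ_const_iff)
qed

text \<open>In the fundamental formula for a power of \<open>x\<^sub>j\<close> only one summand survives.\<close>

lemma fox_ab_x_pro_pow_same:
  "fox_ab j (pro_pow F T (x j) c) * mps_var j = zl_power (1 + mps_var j) c - 1"
proof -
  let ?p = "pro_pow F T (x j) c"
  have "ab_of ?p = 1 + (\<Sum>k\<in>{1..r}. fox_ab k ?p * mps_var k)"
    by (rule fox_ab_fundamental[OF x_pow_closed])
  also have "(\<Sum>k\<in>{1..r}. fox_ab k ?p * mps_var k) = (\<Sum>k\<in>{j}. fox_ab k ?p * mps_var k)"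
    using j fox_ab_x_pro_pow by (intro sum.mono_neutral_right) auto
  finally show ?thesis by (simp add: ab_of_x_pro_pow)
qed

end

text \<open>Instead of differentiating the inverse of \<open>y\<close>, differentiate both sides of
  \<open>(y p y\<^sup>-\<^sup>1) y = y p\<close>.\<close>

lemma fox_ab_gconj:
  assumes y: "y \<in> carrier F" and p: "p \<in> carrier F" and k: "k \<in> {1..r}"
  shows "fox_ab k (gconj F y p) = (1 - ab_of p) * fox_ab k y + ab_of y * fox_ab k p"
proof -
  have b: "gconj F y p \<in> carrier F" using y p by (simp add: gconj_def)
  have "ab_of y * ab_of (inv y) = 1" using y by (simp add: ab_of_mult[symmetric] ab_of_one)
  then have ab: "ab_of (gconj F y p) = ab_of p"
    using y p by (simp add: gconj_def ab_of_mult algebra_simps)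
  have "gconj F y p \<otimes> y = y \<otimes> p" using y p by (simp add: gconj_def m_assoc)
  then have "fox_ab k (gconj F y p \<otimes> y) = fox_ab k (y \<otimes> p)" by simp
  then have "fox_ab k (gconj F y p) + ab_of p * fox_ab k y = fox_ab k y + ab_of y * fox_ab k p"
    using y p b k by (simp add: fox_ab_mult ab)
  then show ?thesis by (simp add: algebra_simps)
qed

lemma magnus_coeff_outside:
  "g \<in> carrier F \<Longrightarrow> \<not> set w \<subseteq> {1..r} \<Longrightarrow> magnus_coeff F T \<Theta> w g = 0"
  by (simp add: magnus_coeff_def Theta_outside cga_of_closed)

lemma fox_ab_series:
  assumes g: "g \<in> carrier F" and k: "k \<in> {1..r}"
  shows "fox_ab k g = mps_const (magnus_coeff F T \<Theta> [k] g) +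
    (\<Sum>n. \<Sum>w\<in>words r (Suc n). mps_const (magnus_coeff F T \<Theta> (w @ [k]) g) * mono_u w)"
proof -
  let ?f = "\<lambda>w. magnus_coeff F T \<Theta> (w @ [k]) g"
  have "fox_ab k g - mps_const (?f []) =
      Abs_mps (\<lambda>m. if m = {#} then 0 else \<Sum>w | mset w = m \<and> set w \<subseteq> {1..r}. ?f w)"
  proof (rule mps_eqI)
    fix m
    have "(\<Sum>w | mset w = m. ?f w) = (\<Sum>w | mset w = m \<and> set w \<subseteq> {1..r}. ?f w)"
      using finite_mset_eq[of m "\<lambda>_. True"] magnus_coeff_outside[OF g]
      by (intro sum.mono_neutral_right) auto
    moreover have "(\<Sum>w | mset w = {#}. ?f w) = ?f []" by simp
    ultimately show "mps_nth (fox_ab k g - mps_const (?f [])) m =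
        mps_nth (Abs_mps (\<lambda>m. if m = {#} then 0 else \<Sum>w | mset w = m \<and> set w \<subseteq> {1..r}. ?f w)) m"
      by (cases "m = {#}")
         (simp_all only: mps_nth_arith mps_nth_fox_ab[OF g k] mps_nth_const Abs_mps_inverse UNIV_I
            if_True if_False diff_self diff_0_right simp_thms)
  qed
  then show ?thesis using sums_unique[OF word_series_sums[where r = r and f = ?f]] by (simp add: algebra_simps)
qed

text \<open>Omitting \<open>k = i\<close> on the left omits the words ending in \<open>i\<close> on the right, since the factor \<open>u\<^sub>k\<close>
  accounts for the last letter.\<close>

lemma fox_ab_partial_series:
  assumes g: "g \<in> carrier F" and i: "i \<in> {1..r}"
  shows "(\<Sum>k\<in>{1..r} - {i}. fox_ab k g * mps_var k) =
    (\<Sum>n. \<Sum>w | w \<in> words r (Suc n) \<and> last w \<noteq> i. mps_const (magnus_coeff F T \<Theta> w g) * mono_u w)"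
proof -
  let ?f = "\<lambda>w. if last w \<noteq> i then magnus_coeff F T \<Theta> w g else 0"
  have "(\<Sum>k\<in>{1..r} - {i}. fox_ab k g * mps_var k) =
      Abs_mps (\<lambda>m. if m = {#} then 0 else \<Sum>w | mset w = m \<and> set w \<subseteq> {1..r}. ?f w)"
  proof (rule mps_eqI)
    fix m
    have lhs: "mps_nth (\<Sum>k\<in>{1..r} - {i}. fox_ab k g * mps_var k) m =
        (\<Sum>k\<in>{1..r} - {i}. if k \<in># m then \<Sum>v | mset v = m - {#k#}. ?f (v @ [k]) else 0)"
      unfolding mps_nth_sum
      by (intro sum.cong refl) (simp add: mps_nth_mult_var mps_nth_fox_ab[OF g])
    also have "\<dots> = (\<Sum>k\<in>{1..r}. if k \<in># m then \<Sum>v | mset v = m - {#k#}. ?f (v @ [k]) else 0)"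
      by (intro sum.mono_neutral_left) auto
    also have "\<dots> = (if m = {#} then 0 else \<Sum>w | mset w = m \<and> set w \<subseteq> {1..r}. ?f w)"
    \<comment> \<open>Outside the alphabet both sides vanish; the case is separate because grouping by last
        letters needs the letters of \<open>m\<close> in the index set.\<close>
    proof (cases "m = {#} \<or> \<not> set_mset m \<subseteq> {1..r}")
      case True
      have "(if k \<in># m then \<Sum>v | mset v = m - {#k#}. ?f (v @ [k]) else 0) = 0"
        if "k \<in> {1..r}" for k
      proof (cases "k \<in># m")
        case km: True
        have "?f (v @ [k]) = 0" if "mset v = m - {#k#}" for v
        proof -
          have "m = mset (v @ [k])" using that km by simp
          then have "set_mset m = set (v @ [k])" by (metis set_mset_mset)
          then show ?thesis using True km magnus_coeff_outside[OF g, of "v @ [k]"] by auto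
        qed
        then show ?thesis by (simp add: sum.neutral)
      qed simp
      then have "(\<Sum>k\<in>{1..r}. if k \<in># m then \<Sum>v | mset v = m - {#k#}. ?f (v @ [k]) else 0) = 0"
        by (rule sum.neutral[OF ballI])
      moreover have "(if m = {#} then 0 else \<Sum>w | mset w = m \<and> set w \<subseteq> {1..r}. ?f w) = 0"
      proof (cases "m = {#}")
        case False
        then have none: "{w. mset w = m \<and> set w \<subseteq> {1..r}} = {}" using True by auto
        show ?thesis unfolding none by simp
      qed simp
      ultimately show ?thesis by simp
    next
      case False
      then have all: "{w. mset w = m \<and> set w \<subseteq> {1..r}} = {w. mset w = m}" by auto
      show ?thesis
        unfolding all using False sum_mset_eq_split_last[of m "{1..r}" ?f] by simp
    qed
    finally show "mps_nth (\<Sum>k\<in>{1..r} - {i}. fox_ab k g * mps_var k) m =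
        mps_nth (Abs_mps (\<lambda>m. if m = {#} then 0 else \<Sum>w | mset w = m \<and> set w \<subseteq> {1..r}. ?f w)) m"
      by (simp only: Abs_mps_inverse UNIV_I)
  qed
  also have "\<dots> = (\<Sum>n. \<Sum>w\<in>words r (Suc n). mps_const (?f w) * mono_u w)"
    by (rule sums_unique[OF word_series_sums])
  also have "(\<lambda>n. \<Sum>w\<in>words r (Suc n). mps_const (?f w) * mono_u w) =
      (\<lambda>n. \<Sum>w | w \<in> words r (Suc n) \<and> last w \<noteq> i. mps_const (magnus_coeff F T \<Theta> w g) * mono_u w)"
  proof
    fix n
    have "(\<Sum>w\<in>words r (Suc n). mps_const (?f w) * mono_u w) =
        (\<Sum>w\<in>words r (Suc n). if last w \<noteq> i then mps_const (magnus_coeff F T \<Theta> w g) * mono_u w else 0)"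
      by (intro sum.cong) auto
    then show "(\<Sum>w\<in>words r (Suc n). mps_const (?f w) * mono_u w) =
        (\<Sum>w | w \<in> words r (Suc n) \<and> last w \<noteq> i. mps_const (magnus_coeff F T \<Theta> w g) * mono_u w)"
      by (simp only: sum.inter_filter[OF finite_words])
  qed
  finally show ?thesis .
qed

text \<open>In the diagonal case the Fox derivative of the power is the quotient \<open>q\<close> of \<open>(1 + u\<^sub>i)\<^sup>c - 1\<close> by \<open>u\<^sub>i\<close>, and
  the term \<open>- q u\<^sub>i\<close> times \<open>fox_ab i y\<close> cancels against the summand \<open>k = i\<close> of the fundamental formula
  for \<open>y\<close>.\<close>

lemma fox_ab_conj_x:
  fixes c :: "'l zl"
  assumes y: "y \<in> carrier F" and i: "i \<in> {1..r}" and j: "j \<in> {1..r}"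
  shows "i \<noteq> j \<Longrightarrow> fox_ab i (gconj F y (pro_pow F T (x j) c)) =
      - (zl_power (1 + mps_var j) c - 1) * fox_ab i y"
    and "fox_ab i (gconj F y (pro_pow F T (x i) c)) =
      mps_quot (zl_power (1 + mps_var i) c - 1) (mps_var i) *
        (1 + (\<Sum>k\<in>{1..r} - {i}. fox_ab k y * mps_var k))"
proof -
  show "fox_ab i (gconj F y (pro_pow F T (x j) c)) = - (zl_power (1 + mps_var j) c - 1) * fox_ab i y"
    if "i \<noteq> j"
    using fox_ab_gconj[OF y x_pow_closed[OF j] i] fox_ab_x_pro_pow[OF j i that] ab_of_x_pro_pow[OF j]
    by simp
  let ?p = "pro_pow F T (x i) c"
  let ?q = "fox_ab i ?p"
  have q: "?q * mps_var i = zl_power (1 + mps_var i) c - 1" by (rule fox_ab_x_pro_pow_same[OF i])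
  have "fox_ab i (gconj F y ?p) = (1 - ab_of ?p) * fox_ab i y + ab_of y * ?q"
    by (rule fox_ab_gconj[OF y x_pow_closed[OF i] i])
  also have "1 - ab_of ?p = - (?q * mps_var i)" by (simp add: q ab_of_x_pro_pow[OF i])
  also have "ab_of y = 1 + (fox_ab i y * mps_var i + (\<Sum>k\<in>{1..r} - {i}. fox_ab k y * mps_var k))"
    using fox_ab_fundamental[OF y]
      sum.remove[OF finite_atLeastAtMost i, of "\<lambda>k. fox_ab k y * mps_var k"] by simp
  finally have "fox_ab i (gconj F y ?p) = ?q * (1 + (\<Sum>k\<in>{1..r} - {i}. fox_ab k y * mps_var k))"
    by (simp add: algebra_simps)
  then show "fox_ab i (gconj F y ?p) = mps_quot (zl_power (1 + mps_var i) c - 1) (mps_var i) *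
        (1 + (\<Sum>k\<in>{1..r} - {i}. fox_ab k y * mps_var k))"
    using mps_quot_var[OF q[symmetric]] by simp
qed

end

section \<open>The Gassner cocycle in terms of Milnor numbers\<close>

theorem proposition4p3p4:
  fixes r :: nat
    and F :: "'g monoid" and T :: "'g topology" and x :: "nat \<Rightarrow> 'g"
    and S :: "nat \<Rightarrow> p1point"
    and \<iota> :: "'g \<Rightarrow> falg \<Rightarrow> falg"
    and Ih :: "(complex \<Rightarrow> complex) \<Rightarrow> 'g \<Rightarrow> 'g"
    and y :: "nat \<Rightarrow> (complex \<Rightarrow> complex) \<Rightarrow> 'g"
    and \<Theta> :: "('g set \<Rightarrow> 'g set \<Rightarrow> 'l::prime_card zl) \<Rightarrow> nat list \<Rightarrow> 'l zl"
    and \<theta> :: "('g set set \<Rightarrow> 'g set set \<Rightarrow> 'l zl) \<Rightarrow> 'l zl mps"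
    and D :: "nat \<Rightarrow> ('g set \<Rightarrow> 'g set \<Rightarrow> 'l zl) \<Rightarrow> ('g set \<Rightarrow> 'g set \<Rightarrow> 'l zl)"
    and \<chi>\<Lambda> :: "(complex \<Rightarrow> complex) \<Rightarrow> 'l zl mps \<Rightarrow> 'l zl mps"
    and g :: "complex \<Rightarrow> complex" and i j :: nat
  assumes "r \<ge> 2"
    and "free_pro_l_group CARD('l) r F T x"
    and "marked_points r S"
    and "is_identification CARD('l) F T r x S \<iota>"
    and "is_ihara_rep TYPE('l) F T r x S \<iota> Ih"
    and "is_longitudes TYPE('l) F T r x S Ih y"
    and "is_Theta F T r x \<Theta>"
    and "is_theta F T r x \<theta>"
    and "is_fox F T r x D"
    and "\<forall>h\<in>gal Qbar (base_field r S). is_chi_Lambda r (cyclotomic h) (\<chi>\<Lambda> h)"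
    and "g \<in> gal Qbar (base_field r S)"
    and "i \<in> {1..r}" and "j \<in> {1..r}"
  shows "gassner F T x Ih D \<theta> g i j =
    (if i = j then
       mps_quot (\<chi>\<Lambda> g (mps_var i)) (mps_var i) *
         (1 + (\<Sum>n. \<Sum>w | w \<in> words r (Suc n) \<and> last w \<noteq> i.
                  mps_const (milnor F T \<Theta> y g (w @ [i])) * mono_u w))
     else
       - \<chi>\<Lambda> g (mps_var j) *
         (mps_const (milnor F T \<Theta> y g [i, j]) +
          (\<Sum>n. \<Sum>w\<in>words r (Suc n).
              mps_const (milnor F T \<Theta> y g (w @ [i, j])) * mono_u w)))"
proof -
  interpret fox_calculus F T "CARD('l)" r x \<Theta> \<theta> D
    using assms(2,7-9)
    by unfold_locales (auto simp: free_pro_l_group_def pro_l_group_def)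
  let ?c = "cyclotomic g :: 'l zl"
  have y: "y j g \<in> carrier F"
    and Ih: "Ih g (x j) = gconj F (y j g) (pro_pow F T (x j) ?c)"
    using assms(6,11,13) by (auto simp: is_longitudes_def)
  have chi: "\<chi>\<Lambda> g (mps_var j) = zl_power (1 + mps_var j) ?c - 1"
    using assms(10,11,13) by (auto simp: is_chi_Lambda_def)
  have gass: "gassner F T x Ih D \<theta> g i j = fox_ab i (gconj F (y j g) (pro_pow F T (x j) ?c))"
    by (simp add: gassner_def fox_ab_def ab_def Ih)
  show ?thesis
  proof (cases "i = j")
    case True
    have "milnor F T \<Theta> y g (w @ [j]) = magnus_coeff F T \<Theta> w (y j g)" if "w \<in> words r (Suc n)" for w n
      using that by (auto simp: milnor_def words_def)
    then have "(\<Sum>w | w \<in> words r (Suc n) \<and> last w \<noteq> j. mps_const (milnor F T \<Theta> y g (w @ [j])) * mono_u w) =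
        (\<Sum>w | w \<in> words r (Suc n) \<and> last w \<noteq> j. mps_const (magnus_coeff F T \<Theta> w (y j g)) * mono_u w)" for n
      by (intro sum.cong) auto
    then show ?thesis
      using fox_ab_conj_x(2)[OF y assms(13,13)] fox_ab_partial_series[OF y assms(13)] gass True
      by (simp add: chi)
  next
    case False
    have "milnor F T \<Theta> y g (w @ [i, j]) = magnus_coeff F T \<Theta> (w @ [i]) (y j g)" for w
      by (simp add: milnor_def butlast_append)
    from this this[of "[]"] show ?thesis
      using fox_ab_conj_x(1)[OF y assms(12,13) False] fox_ab_series[OF y assms(12)] False
      by (simp add: gass chi)
  qed
qed

end
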